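(* Assume that the non-negative matrix $A$ is irreducible, that is, there exists a power $A^n$ all of whose entries are positive. Let $\delta_A$ be the Hausdorff dimension of $\Lambda_A$ and $\mu=\mu_A$ the corresponding (normalized) Hausdorff measure on $\Lambda_A$. Then: 1. On the sets $D_i\subset\Lambda_A$ the Radon–Nikodym derivatives are constant and equal to $$\Phi_{\sigma_i}=\frac{d(\mu\circ\sigma_i)}{d\mu}=N^{-\delta_A}.$$ 2. $\mu(R_i)=p_i$, where $p=(p_i)_{i=0,\dots,N-1}$ is the Perron–Frobenius eigenvector of $A$, i.e. $\sum_jA_{ij}p_j=r(A)p_i$ with $r(A)$ the spectral radius of $A$, $p_i\ge 0$, normalized by $\sum_ip_i=1$. 3. The Hausdorff dimension of $\Lambda_A$ is $$\delta_A=\dim_H(\Lambda_A)=\frac{\log r(A)}{\log N}.$$ 4. The measure $\mu$ satisfies the self-similarity condition $$\mu=N^{-\delta_A}\sum_{k=0}^{N-1}\mu\circ\sigma_k^{-1},$$ where $\mu(\sigma_k^{-1}(E))=\mu(\{x\in D_k:\sigma_k(x)\in E\})$.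
   Context: Let $N\ge 2$ and let $A=(A_{ij})_{i,j=0,\dots,N-1}$ be a matrix with entries in $\{0,1\}$ and $A_{ii}=1$ for all $i$. $\Lambda_A$ is the set of infinite sequences $x=(x_1x_2x_3\dots)$ with $x_i\in\{0,\dots,N-1\}$ and $A_{x_ix_{i+1}}=1$ for all $i\geq 1$, identified with a subset of $[0,1]$ through $x=\sum_{i\ge1}x_iN^{-i}$ (the at most countably many numbers with two expansions are counted as distinct points, one for each admissible expansion). The Hausdorff dimension and measure are those of this subset of $[0,1]$; $\mu_A$ is the $\delta_A$-dimensional Hausdorff measure normalized to total mass one. $R_i=\{x\in\Lambda_A: x_1=i\}$, $D_i=\{x\in\Lambda_A: A_{ix_1}=1\}$, and $\sigma_i:D_i\to R_i$ is $\sigma_i(x)=ix$ (i.e. $\sigma_i(x)=(x+i)/N$ on numbers). The Radon–Nikodym derivative $d(\mu\circ\sigma_i)/d\mu$ is that of the measure $B\mapsto\mu(\sigma_i(B))$ on $D_i$. *)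

theory Defs
  imports "HOL-Analysis.Analysis" "Jordan_Normal_Form.Spectral_Radius"
begin

unbundle no vec_syntax

section \<open>Hausdorff measure and dimension\<close>

text \<open>The case split fixes the convention \<open>0\<^sup>0 = 1\<close> for nonempty sets (Isabelle has
  \<open>0 powr 0 = 0\<close>), so that the measure of exponent \<open>0\<close> is counting measure.\<close>

definition hausdorff_gauge :: "real \<Rightarrow> 'a::metric_space set \<Rightarrow> ennreal" where
  "hausdorff_gauge s U =
     (if U = {} then 0 else if s = 0 then 1 else ennreal (diameter U powr s))"

text \<open>Boundedness is required explicitly because \<open>diameter\<close> is only meaningful on bounded sets.\<close>

definition hausdorff_premeasure :: "real \<Rightarrow> real \<Rightarrow> 'a::metric_space set \<Rightarrow> ennreal" where
  "hausdorff_premeasure s \<epsilon> E =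
     (INF U \<in> {U :: nat \<Rightarrow> 'a set. E \<subseteq> (\<Union>n. U n) \<and> (\<forall>n. bounded (U n) \<and> diameter (U n) \<le> \<epsilon>)}.
        (\<Sum>n. hausdorff_gauge s (U n)))"

definition hausdorff_outer_measure :: "real \<Rightarrow> 'a::metric_space set \<Rightarrow> ennreal" where
  "hausdorff_outer_measure s E = (SUP \<epsilon>\<in>{0<..}. hausdorff_premeasure s \<epsilon> E)"

definition hausdorff_dim :: "'a::metric_space set \<Rightarrow> ereal" where
  "hausdorff_dim E = (INF s \<in> {s. 0 \<le> s \<and> hausdorff_outer_measure s E = 0}. ereal s)"


section \<open>The limit set of a 0-1 matrix\<close>

text \<open>The number \<open>N\<close> of digits is \<open>dim_row A\<close>.  Sequences are indexed from \<open>0\<close>: the digit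
  \<open>x\<^sub>i\<close> (\<open>i \<ge> 1\<close>) is \<open>x (i - 1)\<close>.\<close>

definition Lambda :: "real mat \<Rightarrow> (nat \<Rightarrow> nat) set" where
  "Lambda A = {x. \<forall>n. x n < dim_row A \<and> A $$ (x n, x (Suc n)) = 1}"

definition expansion_value :: "nat \<Rightarrow> (nat \<Rightarrow> nat) \<Rightarrow> real" where
  "expansion_value N x = (\<Sum>n. real (x n) / real N ^ Suc n)"

abbreviation Lambda_real :: "real mat \<Rightarrow> real set" where
  "Lambda_real A \<equiv> expansion_value (dim_row A) ` Lambda A"

definition range_set :: "real mat \<Rightarrow> nat \<Rightarrow> (nat \<Rightarrow> nat) set" where
  "range_set A i = {x \<in> Lambda A. x 0 = i}"

definition domain_set :: "real mat \<Rightarrow> nat \<Rightarrow> (nat \<Rightarrow> nat) set" where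
  "domain_set A i = {x \<in> Lambda A. A $$ (i, x 0) = 1}"

definition prepend :: "nat \<Rightarrow> (nat \<Rightarrow> nat) \<Rightarrow> nat \<Rightarrow> nat" where
  "prepend i x = case_nat i x"

text \<open>The real number \<open>delta A\<close> has its intended meaning as soon as the dimension is finite,
  which the theorem also asserts.\<close>

definition delta :: "real mat \<Rightarrow> real" where
  "delta A = real_of_ereal (hausdorff_dim (Lambda_real A))"

text \<open>The normalized Hausdorff measure lives on the space of admissible sequences, so that
  the two expansions of a number are distinct points; a set of sequences is measured by the
  Hausdorff measure of the set of numbers it represents.  Only countably many numbers
  have two expansions, so for positive exponent overlaps of images are null and this
  is countably additive on the Borel sets (of the product topology).\<close>

definition mu :: "real mat \<Rightarrow> (nat \<Rightarrow> nat) measure" where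
  "mu A = measure_of (Lambda A) (sets (restrict_space borel (Lambda A)))
     (\<lambda>B. hausdorff_outer_measure (delta A) (expansion_value (dim_row A) ` B)
          / hausdorff_outer_measure (delta A) (Lambda_real A))"

abbreviation mu_on_domain :: "real mat \<Rightarrow> nat \<Rightarrow> (nat \<Rightarrow> nat) measure" where
  "mu_on_domain A i \<equiv> restrict_space (mu A) (domain_set A i)"

definition mu_comp_prepend :: "real mat \<Rightarrow> nat \<Rightarrow> (nat \<Rightarrow> nat) measure" where
  "mu_comp_prepend A i = measure_of (domain_set A i) (sets (mu_on_domain A i))
     (\<lambda>B. emeasure (mu A) (prepend i ` B))"

abbreviation perron_root :: "real mat \<Rightarrow> real" where
  "perron_root A \<equiv> spectral_radius (map_mat complex_of_real A)"

definition perron_frobenius_vector :: "real mat \<Rightarrow> real vec \<Rightarrow> bool" where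
  "perron_frobenius_vector A p \<longleftrightarrow>
     eigenvector A p (perron_root A) \<and>
     (\<forall>i<dim_row A. 0 \<le> p $ i) \<and> (\<Sum>i<dim_row A. p $ i) = 1"

end

theory Submission
  imports Defs
begin

text \<open>Write \<open>r\<close> for the spectral radius of \<open>A\<close> and \<open>s = ln r / ln N\<close>, so that \<open>N\<^sup>s = r\<close>.  Everything
  rests on the self-similarity of the limit set: prepending the digit \<open>i\<close> acts on numbers as the
  similarity \<open>x \<mapsto> (x + i)/N\<close>, hence multiplies Hausdorff measure of exponent \<open>s\<close> by
  \<open>N\<^sup>-\<^sup>s = 1/r\<close> (\<open>hm_prepend\<close>), and \<open>range_set A i\<close> is the image of the disjoint union of the
  \<open>range_set A j\<close> with \<open>A\<^sub>i\<^sub>j = 1\<close>.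

  The first point is that the Hausdorff measure \<open>hm\<close> of exponent \<open>s\<close> of the limit set is positive and finite, which
  identifies \<open>s\<close> as the dimension (\<open>hausdorff_dim_eqI\<close>).  Finiteness (\<open>hm_Lambda_finite\<close>) follows
  by applying the similarities repeatedly to a trivial cover; the positive
  eigenvector \<open>p\<close> keeps the cost of the covers bounded.  Positivity (\<open>hm_Lambda_pos\<close>) is a mass
  distribution argument: \<open>cylinder_cover_weight_ge\<close> shows, without constructing a
  measure, that covers by cylinders cannot be too cheap.

  The second point is that \<open>hm\<close> is countably additive on Borel sets of sequences
  (\<open>measure_space_hm\<close>), although the expansion map is not injective: cylinders satisfy
  Caratheodory's criterion, as the parts of a cylinder near its two end points have
  small measure (\<open>cylinder_caratheodory\<close>).

  The rest is formal.  The scaling factor \<open>1/r\<close> is the Radon--Nikodym derivative, and splitting a set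
  by its first digit gives the self-similarity of the measure.  Applied to the sets
  \<open>range_set A i\<close>, scaling and additivity say that their measures form an eigenvector for \<open>r\<close>, which must be the
  Perron--Frobenius vector by uniqueness (\<open>perron_vector_unique\<close>).  Existence of this vector
  comes from the growth of the powers of a matrix, controlled by its spectral radius.\<close>

section \<open>Hausdorff outer measure\<close>

lemma hausdorff_gauge_empty [simp]: "hausdorff_gauge s {} = 0"
  by (simp add: hausdorff_gauge_def)

lemma hausdorff_gauge_eq: "s \<noteq> 0 \<Longrightarrow> hausdorff_gauge s U = ennreal (diameter U powr s)"
  by (simp add: hausdorff_gauge_def)

lemma hausdorff_premeasure_le:
  assumes "E \<subseteq> (\<Union>n. U n)" "\<And>n. bounded (U n)" "\<And>n. diameter (U n) \<le> \<epsilon>"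
  shows "hausdorff_premeasure s \<epsilon> E \<le> (\<Sum>n. hausdorff_gauge s (U n))"
  unfolding hausdorff_premeasure_def using assms by (intro INF_lower) auto

lemma hausdorff_premeasure_mono:
  "E \<subseteq> F \<Longrightarrow> hausdorff_premeasure s \<epsilon> E \<le> hausdorff_premeasure s \<epsilon> F"
  unfolding hausdorff_premeasure_def by (rule INF_superset_mono) auto

lemma hausdorff_premeasure_antimono:
  "\<epsilon> \<le> \<epsilon>' \<Longrightarrow> hausdorff_premeasure s \<epsilon>' E \<le> hausdorff_premeasure s \<epsilon> E"
  unfolding hausdorff_premeasure_def by (rule INF_superset_mono) (auto intro: order_trans)

lemma hausdorff_premeasure_empty [simp]: "\<epsilon> \<ge> 0 \<Longrightarrow> hausdorff_premeasure s \<epsilon> {} = 0"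
  using hausdorff_premeasure_le[of "{}" "\<lambda>_. {}" \<epsilon> s] by simp

lemma hausdorff_premeasure_le_outer:
  "\<epsilon> > 0 \<Longrightarrow> hausdorff_premeasure s \<epsilon> E \<le> hausdorff_outer_measure s E"
  unfolding hausdorff_outer_measure_def by (rule SUP_upper) simp

lemma hausdorff_outer_measure_least:
  "(\<And>\<epsilon>. \<epsilon> > 0 \<Longrightarrow> hausdorff_premeasure s \<epsilon> E \<le> z) \<Longrightarrow> hausdorff_outer_measure s E \<le> z"
  unfolding hausdorff_outer_measure_def by (rule SUP_least) simp

lemma hausdorff_outer_measure_mono:
  "E \<subseteq> F \<Longrightarrow> hausdorff_outer_measure s E \<le> hausdorff_outer_measure s F"
  unfolding hausdorff_outer_measure_def by (rule SUP_mono') (rule hausdorff_premeasure_mono)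

lemma hausdorff_outer_measure_empty [simp]: "hausdorff_outer_measure s {} = 0"
  using hausdorff_outer_measure_least[of s "{}" 0] by simp

lemma hausdorff_premeasure_lessE:
  assumes "hausdorff_premeasure s \<epsilon> E < z"
  obtains U :: "nat \<Rightarrow> 'a::metric_space set"
  where "E \<subseteq> (\<Union>n. U n)" "\<And>n. bounded (U n)" "\<And>n. diameter (U n) \<le> \<epsilon>"
    "(\<Sum>n. hausdorff_gauge s (U n)) < z"
  using assms unfolding hausdorff_premeasure_def INF_less_iff by auto

lemma le_mult_hausdorff_premeasureI:
  fixes E :: "'a::metric_space set"
  assumes c: "c > 0"
    and le: "\<And>U :: nat \<Rightarrow> 'a set. E \<subseteq> (\<Union>n. U n) \<Longrightarrow> (\<And>n. bounded (U n)) \<Longrightarrow>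
      (\<And>n. diameter (U n) \<le> \<epsilon>) \<Longrightarrow> z \<le> (\<Sum>n. ennreal c * hausdorff_gauge s (U n))"
  shows "z \<le> ennreal c * hausdorff_premeasure s \<epsilon> E"
proof -
  have "z / ennreal c \<le> hausdorff_premeasure s \<epsilon> E"
    unfolding hausdorff_premeasure_def
  proof (rule INF_greatest)
    fix U :: "nat \<Rightarrow> 'a set"
    assume "U \<in> {U. E \<subseteq> \<Union> (range U) \<and> (\<forall>n. bounded (U n) \<and> diameter (U n) \<le> \<epsilon>)}"
    then have "z \<le> ennreal c * (\<Sum>n. hausdorff_gauge s (U n))"
      using le[of U] by auto
    then show "z / ennreal c \<le> (\<Sum>n. hausdorff_gauge s (U n))"
      using c by (intro divide_le_posI_ennreal) (auto simp: ennreal_zero_less_divide)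
  qed
  then have "z / ennreal c * ennreal c \<le> hausdorff_premeasure s \<epsilon> E * ennreal c"
    by (rule mult_right_mono) simp
  moreover have "z / ennreal c * ennreal c = z"
    unfolding ennreal_divide_times using c by simp
  ultimately show ?thesis by (simp add: mult.commute)
qed

lemma hausdorff_premeasure_UN_le:
  fixes E :: "nat \<Rightarrow> 'a::metric_space set"
  shows "hausdorff_premeasure s \<epsilon> (\<Union>k. E k) \<le> (\<Sum>k. hausdorff_premeasure s \<epsilon> (E k))"
proof (rule ennreal_le_epsilon)
  fix e :: real
  let ?O = "hausdorff_premeasure s \<epsilon>"
  assume "0 < e" "(\<Sum>k. ?O (E k)) < top_class.top"
  have *: "?O (E n) < ?O (E n) + ennreal (e * (1/2)^Suc n)" for n
  proof -
    have "?O (E n) < top_class.top"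
      by (rule ennreal_suminf_lessD) fact
    then obtain a where a: "?O (E n) = ennreal a" "a \<ge> 0"
      by (cases "?O (E n)") auto
    have "a < a + e * (1/2)^Suc n" using \<open>0 < e\<close> by simp
    then have "ennreal a < ennreal (a + e * (1/2)^Suc n)"
      using a by (intro ennreal_lessI) auto
    then show ?thesis using a \<open>0 < e\<close> by (simp add: ennreal_plus)
  qed
  have "\<exists>U. E n \<subseteq> (\<Union>m. U m) \<and> (\<forall>m. bounded (U m) \<and> diameter (U m) \<le> \<epsilon>)
      \<and> (\<Sum>m. hausdorff_gauge s (U m)) \<le> ?O (E n) + ennreal (e * (1/2)^Suc n)" for n
  proof -
    obtain U where "E n \<subseteq> (\<Union>m. U m)" "\<And>m. bounded (U m)" "\<And>m. diameter (U m) \<le> \<epsilon>"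
      "(\<Sum>m. hausdorff_gauge s (U m)) < ?O (E n) + ennreal (e * (1/2)^Suc n)"
      by (rule hausdorff_premeasure_lessE[OF *[of n]]) blast
    then show ?thesis by (intro exI[of _ U]) (simp add: less_imp_le)
  qed
  then obtain B where B: "\<And>n. E n \<subseteq> (\<Union>m. B n m)"
      "\<And>n m. bounded (B n m)" "\<And>n m. diameter (B n m) \<le> \<epsilon>"
      "\<And>n. (\<Sum>m. hausdorff_gauge s (B n m)) \<le> ?O (E n) + ennreal (e * (1/2)^Suc n)"
    by metis
  \<comment> \<open>all the covers together, enumerated by a single index\<close>
  define C where "C = case_prod B o prod_decode"
  have "(\<Union>i. E i) \<subseteq> (\<Union>i. C i)"
    using B(1) by (auto simp add: C_def subset_eq) (metis prod.case prod_encode_inverse)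
  then have "?O (\<Union>i. E i) \<le> (\<Sum>i. hausdorff_gauge s (C i))"
    by (rule hausdorff_premeasure_le) (auto simp: C_def split_def B)
  also have "\<dots> = (\<Sum>n. \<Sum>i. hausdorff_gauge s (B n i))"
    unfolding C_def comp_def
    using suminf_ennreal_2dimen[where f = "\<lambda>p. hausdorff_gauge s (case_prod B p)"] by auto
  also have "\<dots> \<le> (\<Sum>n. ?O (E n) + ennreal (e * (1/2) ^ Suc n))"
    by (intro suminf_le allI B(4)) auto
  also have "... = (\<Sum>n. ?O (E n)) + (\<Sum>n. ennreal e * ennreal ((1/2) ^ Suc n))"
    using \<open>0 < e\<close> by (subst suminf_add[symmetric])
                     (auto simp del: ennreal_suminf_cmult simp add: ennreal_mult[symmetric])
  also have "\<dots> = (\<Sum>n. ?O (E n)) + e"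
    unfolding ennreal_suminf_cmult
    by (subst suminf_ennreal_eq[OF zero_le_power power_half_series]) auto
  finally show "?O (\<Union>i. E i) \<le> (\<Sum>n. ?O (E n)) + ennreal e" .
qed

lemma hausdorff_outer_measure_UN_le:
  fixes E :: "nat \<Rightarrow> 'a::metric_space set"
  shows "hausdorff_outer_measure s (\<Union>k. E k) \<le> (\<Sum>k. hausdorff_outer_measure s (E k))"
proof (rule hausdorff_outer_measure_least)
  fix \<epsilon> :: real assume "\<epsilon> > 0"
  have "hausdorff_premeasure s \<epsilon> (\<Union>k. E k) \<le> (\<Sum>k. hausdorff_premeasure s \<epsilon> (E k))"
    by (rule hausdorff_premeasure_UN_le)
  also have "\<dots> \<le> (\<Sum>k. hausdorff_outer_measure s (E k))"
    by (intro suminf_le allI hausdorff_premeasure_le_outer \<open>\<epsilon> > 0\<close>) auto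
  finally show "hausdorff_premeasure s \<epsilon> (\<Union>k. E k) \<le> (\<Sum>k. hausdorff_outer_measure s (E k))" .
qed

lemma hausdorff_premeasure_Un_le:
  assumes "\<epsilon> \<ge> 0"
  shows "hausdorff_premeasure s \<epsilon> (E \<union> F) \<le> hausdorff_premeasure s \<epsilon> E + hausdorff_premeasure s \<epsilon> F"
proof -
  let ?B = "binaryset E F"
  have "(\<Sum>k. hausdorff_premeasure s \<epsilon> (?B k)) = hausdorff_premeasure s \<epsilon> E + hausdorff_premeasure s \<epsilon> F"
    by (rule suminf_binaryset_eq) (simp add: assms)
  then show ?thesis
    using hausdorff_premeasure_UN_le[of s \<epsilon> ?B] by (simp add: UN_binaryset_eq)
qed

lemma hausdorff_outer_measure_Un_le:
  "hausdorff_outer_measure s (E \<union> F) \<le> hausdorff_outer_measure s E + hausdorff_outer_measure s F"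
proof (rule hausdorff_outer_measure_least)
  fix \<epsilon> :: real assume "\<epsilon> > 0"
  then show "hausdorff_premeasure s \<epsilon> (E \<union> F)
      \<le> hausdorff_outer_measure s E + hausdorff_outer_measure s F"
    using hausdorff_premeasure_Un_le[of \<epsilon> s E F]
    by (meson add_mono hausdorff_premeasure_le_outer less_imp_le order_trans)
qed

lemma hausdorff_premeasure_finite_UN_le:
  assumes "finite I" "\<epsilon> \<ge> 0"
  shows "hausdorff_premeasure s \<epsilon> (\<Union>i\<in>I. E i) \<le> (\<Sum>i\<in>I. hausdorff_premeasure s \<epsilon> (E i))"
  using assms(1)
proof induction
  case empty
  then show ?case using assms(2) by simp
next
  case (insert i I)
  have "hausdorff_premeasure s \<epsilon> (E i \<union> (\<Union>i\<in>I. E i))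
      \<le> hausdorff_premeasure s \<epsilon> (E i) + hausdorff_premeasure s \<epsilon> (\<Union>i\<in>I. E i)"
    by (rule hausdorff_premeasure_Un_le[OF assms(2)])
  also have "\<dots> \<le> hausdorff_premeasure s \<epsilon> (E i) + (\<Sum>i\<in>I. hausdorff_premeasure s \<epsilon> (E i))"
    using insert by (intro add_left_mono)
  finally show ?case using insert by simp
qed

text \<open>A Hausdorff outer measure is a metric outer measure: it is additive on two sets at
  positive distance, because a set of diameter less than that distance meets at most one of
  them.\<close>

lemma hausdorff_outer_measure_separated:
  assumes d: "d > 0" "\<And>x y. x \<in> E \<Longrightarrow> y \<in> F \<Longrightarrow> d \<le> dist x y"
  shows "hausdorff_outer_measure s E + hausdorff_outer_measure s F
    \<le> hausdorff_outer_measure s (E \<union> F)"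
proof -
  have key: "hausdorff_premeasure s \<epsilon> E + hausdorff_premeasure s \<epsilon> F
      \<le> hausdorff_premeasure s \<epsilon> (E \<union> F)" if \<epsilon>: "0 < \<epsilon>" "\<epsilon> < d" for \<epsilon>
    unfolding hausdorff_premeasure_def[of s \<epsilon> "E \<union> F"]
  proof (rule INF_greatest, clarify)
    fix U :: "nat \<Rightarrow> 'a set"
    assume U: "E \<union> F \<subseteq> (\<Union>n. U n)" "\<forall>n. bounded (U n) \<and> diameter (U n) \<le> \<epsilon>"
    define V where "V n = (if U n \<inter> E = {} then {} else U n)" for n
    define W where "W n = (if U n \<inter> F = {} then {} else U n)" for n
    have *: "hausdorff_gauge s (V n) + hausdorff_gauge s (W n) \<le> hausdorff_gauge s (U n)" for n
    proof (cases "U n \<inter> E = {} \<or> U n \<inter> F = {}")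
      case False
      then obtain x y where xy: "x \<in> U n" "x \<in> E" "y \<in> U n" "y \<in> F" by auto
      have "dist x y \<le> diameter (U n)"
        using U xy by (intro diameter_bounded_bound) auto
      then show ?thesis using U(2)[rule_format, of n] d(2)[OF xy(2) xy(4)] \<epsilon> by linarith
    qed (auto simp: V_def W_def)
    have "hausdorff_premeasure s \<epsilon> E \<le> (\<Sum>n. hausdorff_gauge s (V n))"
    proof (rule hausdorff_premeasure_le)
      show "E \<subseteq> (\<Union>n. V n)"
      proof
        fix x assume "x \<in> E"
        then obtain n where "x \<in> U n" using U by auto
        with \<open>x \<in> E\<close> show "x \<in> (\<Union>n. V n)" by (auto simp: V_def intro!: exI[of _ n])
      qed
    qed (use U \<epsilon> in \<open>auto simp: V_def\<close>)
    moreover have "hausdorff_premeasure s \<epsilon> F \<le> (\<Sum>n. hausdorff_gauge s (W n))"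
    proof (rule hausdorff_premeasure_le)
      show "F \<subseteq> (\<Union>n. W n)"
      proof
        fix x assume "x \<in> F"
        then obtain n where "x \<in> U n" using U by auto
        with \<open>x \<in> F\<close> show "x \<in> (\<Union>n. W n)" by (auto simp: W_def intro!: exI[of _ n])
      qed
    qed (use U \<epsilon> in \<open>auto simp: W_def\<close>)
    ultimately have "hausdorff_premeasure s \<epsilon> E + hausdorff_premeasure s \<epsilon> F
        \<le> (\<Sum>n. hausdorff_gauge s (V n)) + (\<Sum>n. hausdorff_gauge s (W n))"
      by (rule add_mono)
    also have "\<dots> = (\<Sum>n. hausdorff_gauge s (V n) + hausdorff_gauge s (W n))"
      by (rule suminf_add) auto
    also have "\<dots> \<le> (\<Sum>n. hausdorff_gauge s (U n))"
      by (intro suminf_le allI *) auto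
    finally show "hausdorff_premeasure s \<epsilon> E + hausdorff_premeasure s \<epsilon> F
        \<le> (\<Sum>n. hausdorff_gauge s (U n))" .
  qed
  have "hausdorff_outer_measure s E + hausdorff_outer_measure s F
      = (SUP \<epsilon>\<in>{0<..}. hausdorff_premeasure s \<epsilon> E + hausdorff_premeasure s \<epsilon> F)"
    unfolding hausdorff_outer_measure_def
  proof (rule SUP_add_directed_ennreal[symmetric])
    fix i j :: real assume "i \<in> {0<..}" "j \<in> {0<..}"
    then show "\<exists>k\<in>{0<..}. hausdorff_premeasure s i E + hausdorff_premeasure s j F
        \<le> hausdorff_premeasure s k E + hausdorff_premeasure s k F"
      by (intro bexI[of _ "min i j"] add_mono hausdorff_premeasure_antimono) auto
  qed
  also have "\<dots> \<le> hausdorff_outer_measure s (E \<union> F)"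
  proof (rule SUP_least)
    fix \<epsilon> :: real assume "\<epsilon> \<in> {0<..}"
    let ?e = "min \<epsilon> (d/2)"
    have "hausdorff_premeasure s \<epsilon> E + hausdorff_premeasure s \<epsilon> F
        \<le> hausdorff_premeasure s ?e E + hausdorff_premeasure s ?e F"
      by (intro add_mono hausdorff_premeasure_antimono) auto
    also have "\<dots> \<le> hausdorff_premeasure s ?e (E \<union> F)"
      using \<open>\<epsilon> \<in> {0<..}\<close> d by (intro key) auto
    also have "\<dots> \<le> hausdorff_outer_measure s (E \<union> F)"
      using \<open>\<epsilon> \<in> {0<..}\<close> d by (intro hausdorff_premeasure_le_outer) auto
    finally show "hausdorff_premeasure s \<epsilon> E + hausdorff_premeasure s \<epsilon> F
        \<le> hausdorff_outer_measure s (E \<union> F)" .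
  qed
  finally show ?thesis .
qed

lemma hausdorff_gauge_image_le:
  fixes f :: "'a::metric_space \<Rightarrow> 'b::metric_space"
  assumes f: "\<And>x y. x \<in> U \<Longrightarrow> y \<in> U \<Longrightarrow> dist (f x) (f y) \<le> c * dist x y"
    and c: "c > 0" and s: "s \<ge> 0" and U: "bounded U"
  shows "bounded (f ` U)" "diameter (f ` U) \<le> c * diameter U"
    "hausdorff_gauge s (f ` U) \<le> ennreal (c powr s) * hausdorff_gauge s U"
proof -
  have d: "dist (f x) (f y) \<le> c * diameter U" if "x \<in> U" "y \<in> U" for x y
    using f[OF that] diameter_bounded_bound[OF U that] c
    by (meson mult_left_mono less_imp_le order_trans)
  show b: "bounded (f ` U)"
  proof (cases "U = {}")
    case False
    then obtain x where "x \<in> U" by auto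
    then show ?thesis unfolding bounded_def using d by (auto intro!: exI[of _ "f x"])
  qed simp
  show D: "diameter (f ` U) \<le> c * diameter U"
  proof (cases "U = {}")
    case False
    then show ?thesis using d by (auto simp: diameter_def[of "f ` U"] intro!: cSUP_least)
  qed simp
  show "hausdorff_gauge s (f ` U) \<le> ennreal (c powr s) * hausdorff_gauge s U"
  proof (cases "U = {} \<or> s = 0")
    case True
    then show ?thesis using c by (auto simp: hausdorff_gauge_def)
  next
    case False
    have "diameter (f ` U) powr s \<le> (c * diameter U) powr s"
      using D s diameter_ge_0[OF b] by (intro powr_mono2) auto
    also have "\<dots> = c powr s * diameter U powr s"
      using c diameter_ge_0[OF U] by (simp add: powr_mult)
    finally show ?thesis
      using False by (simp add: hausdorff_gauge_def flip: ennreal_mult)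
  qed
qed

text \<open>A map that expands distances by at most the factor \<open>c\<close> increases Hausdorff measure of exponent
  \<open>s\<close> by at most the factor \<open>c\<^sup>s\<close>, the mesh of the covers being rescaled accordingly.\<close>

lemma hausdorff_premeasure_image_le:
  fixes f :: "'a::metric_space \<Rightarrow> 'b::metric_space"
  assumes f: "\<And>x y. x \<in> E \<Longrightarrow> y \<in> E \<Longrightarrow> dist (f x) (f y) \<le> c * dist x y"
    and c: "c > 0" and s: "s \<ge> 0"
  shows "hausdorff_premeasure s (c * \<epsilon>) (f ` E) \<le> ennreal (c powr s) * hausdorff_premeasure s \<epsilon> E"
proof (rule le_mult_hausdorff_premeasureI)
  fix U :: "nat \<Rightarrow> 'a set"
  assume U: "E \<subseteq> (\<Union>n. U n)" "\<And>n. bounded (U n)" "\<And>n. diameter (U n) \<le> \<epsilon>"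
  have b: "bounded (U n \<inter> E)" for n using U(2) by (rule bounded_subset) auto
  have D: "diameter (U n \<inter> E) \<le> diameter (U n)" for n
    using U(2) by (intro diameter_subset) auto
  have G: "hausdorff_gauge s (U n \<inter> E) \<le> hausdorff_gauge s (U n)" for n
    using D[of n] s diameter_ge_0[OF b[of n]]
    by (auto simp: hausdorff_gauge_def intro!: ennreal_leI powr_mono2)
  note I = hausdorff_gauge_image_le[of "U n \<inter> E" f c s for n]
  have "hausdorff_premeasure s (c * \<epsilon>) (f ` E) \<le> (\<Sum>n. hausdorff_gauge s (f ` (U n \<inter> E)))"
  proof (rule hausdorff_premeasure_le)
    show "f ` E \<subseteq> (\<Union>n. f ` (U n \<inter> E))" using U(1) by blast
    show "bounded (f ` (U n \<inter> E))" for n using I(1)[of n] f c s b by auto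
    have "diameter (f ` (U n \<inter> E)) \<le> c * diameter (U n \<inter> E)" for n
      using I(2)[of n] f c s b by auto
    also have "c * diameter (U n \<inter> E) \<le> c * \<epsilon>" for n
      using c D[of n] U(3)[of n] by simp
    finally show "diameter (f ` (U n \<inter> E)) \<le> c * \<epsilon>" for n .
  qed
  also have "\<dots> \<le> (\<Sum>n. ennreal (c powr s) * hausdorff_gauge s (U n))"
  proof (intro suminf_le allI)
    fix n
    have "hausdorff_gauge s (f ` (U n \<inter> E)) \<le> ennreal (c powr s) * hausdorff_gauge s (U n \<inter> E)"
      using I(3)[of n] f c s b by auto
    also have "\<dots> \<le> ennreal (c powr s) * hausdorff_gauge s (U n)"
      by (rule mult_left_mono[OF G]) simp
    finally show "hausdorff_gauge s (f ` (U n \<inter> E)) \<le> ennreal (c powr s) * hausdorff_gauge s (U n)" .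
  qed auto
  finally show "hausdorff_premeasure s (c * \<epsilon>) (f ` E)
    \<le> (\<Sum>n. ennreal (c powr s) * hausdorff_gauge s (U n))" .
qed (use c in auto)

lemma hausdorff_outer_measure_image_le:
  fixes f :: "'a::metric_space \<Rightarrow> 'b::metric_space"
  assumes f: "\<And>x y. x \<in> E \<Longrightarrow> y \<in> E \<Longrightarrow> dist (f x) (f y) \<le> c * dist x y"
    and c: "c > 0" and s: "s \<ge> 0"
  shows "hausdorff_outer_measure s (f ` E) \<le> ennreal (c powr s) * hausdorff_outer_measure s E"
proof (rule hausdorff_outer_measure_least)
  fix \<epsilon> :: real assume "\<epsilon> > 0"
  have "hausdorff_premeasure s \<epsilon> (f ` E) \<le> ennreal (c powr s) * hausdorff_premeasure s (\<epsilon> / c) E"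
    using hausdorff_premeasure_image_le[OF f c s, of E "\<epsilon> / c"] c by simp
  also have "\<dots> \<le> ennreal (c powr s) * hausdorff_outer_measure s E"
    using c \<open>\<epsilon> > 0\<close> by (intro mult_left_mono hausdorff_premeasure_le_outer) auto
  finally show "hausdorff_premeasure s \<epsilon> (f ` E) \<le> ennreal (c powr s) * hausdorff_outer_measure s E" .
qed

lemma hausdorff_outer_measure_affine:
  fixes E :: "real set"
  assumes c: "c > 0" and s: "s \<ge> 0"
  shows "hausdorff_outer_measure s ((\<lambda>x. a + c * x) ` E) = ennreal (c powr s) * hausdorff_outer_measure s E"
proof (rule antisym)
  show "hausdorff_outer_measure s ((\<lambda>x. a + c * x) ` E) \<le> ennreal (c powr s) * hausdorff_outer_measure s E"
    using c s by (intro hausdorff_outer_measure_image_le)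
      (auto simp: dist_real_def abs_mult simp flip: right_diff_distrib)
  let ?F = "(\<lambda>x. a + c * x) ` E"
  have "(\<lambda>y. (y - a) / c) ` ?F = E" using c by (auto simp: image_image)
  moreover have "hausdorff_outer_measure s ((\<lambda>y. (y - a) / c) ` ?F)
      \<le> ennreal ((1/c) powr s) * hausdorff_outer_measure s ?F"
    using c s by (intro hausdorff_outer_measure_image_le)
      (auto simp: dist_real_def abs_mult abs_divide simp flip: diff_divide_distrib)
  ultimately have "ennreal (c powr s) * hausdorff_outer_measure s E
      \<le> ennreal (c powr s) * (ennreal ((1/c) powr s) * hausdorff_outer_measure s ?F)"
    by (intro mult_left_mono) auto
  also have "\<dots> = hausdorff_outer_measure s ?F"
    using c by (simp add: mult.assoc[symmetric] powr_divide flip: ennreal_mult)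
  finally show "ennreal (c powr s) * hausdorff_outer_measure s E \<le> hausdorff_outer_measure s ?F" .
qed

text \<open>For \<open>t > s\<close>, a set of diameter at most \<open>\<epsilon>\<close> has gauge of exponent \<open>t\<close> at most \<open>\<epsilon>\<close> to the power \<open>t - s\<close>
  times its gauge of exponent \<open>s\<close>, so a finite measure of exponent \<open>s\<close> forces a null
  measure of exponent \<open>t\<close>.  For \<open>t < s\<close> the gauges of small sets only increase.\<close>

lemma hausdorff_dim_eqI:
  assumes s: "s \<ge> 0" and pos: "hausdorff_outer_measure s E \<noteq> 0"
    and fin: "hausdorff_outer_measure s E < \<infinity>"
  shows "hausdorff_dim E = ereal s"
proof (rule antisym)
  have null: "hausdorff_outer_measure t E = 0" if "t > s" for t
  proof -
    have pre: "hausdorff_premeasure t \<epsilon> E \<le> ennreal (\<epsilon> powr (t - s)) * hausdorff_premeasure s \<epsilon> E"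
      if "0 < \<epsilon>" for \<epsilon>
    proof (rule le_mult_hausdorff_premeasureI)
      fix U :: "nat \<Rightarrow> 'a set"
      assume U: "E \<subseteq> (\<Union>n. U n)" "\<And>n. bounded (U n)" "\<And>n. diameter (U n) \<le> \<epsilon>"
      have "hausdorff_premeasure t \<epsilon> E \<le> (\<Sum>n. hausdorff_gauge t (U n))"
        by (rule hausdorff_premeasure_le) (use U in auto)
      also have "\<dots> \<le> (\<Sum>n. ennreal (\<epsilon> powr (t - s)) * hausdorff_gauge s (U n))"
      proof (intro suminf_le allI)
        fix n
        have "diameter (U n) powr t \<le> \<epsilon> powr (t - s) * (if s = 0 then 1 else diameter (U n) powr s)"
        proof -
          have "diameter (U n) powr t = diameter (U n) powr (t - s) * diameter (U n) powr s"
            by (simp flip: powr_add)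
          also have "\<dots> \<le> \<epsilon> powr (t - s) * (if s = 0 then 1 else diameter (U n) powr s)"
            using U(3)[of n] \<open>t > s\<close> diameter_ge_0[OF U(2)[of n]]
            by (intro mult_mono powr_mono2) auto
          finally show ?thesis .
        qed
        then show "hausdorff_gauge t (U n) \<le> ennreal (\<epsilon> powr (t - s)) * hausdorff_gauge s (U n)"
          using s \<open>t > s\<close> by (auto simp: hausdorff_gauge_def ennreal_leI simp flip: ennreal_mult)
      qed auto
      finally show "hausdorff_premeasure t \<epsilon> E
        \<le> (\<Sum>n. ennreal (\<epsilon> powr (t - s)) * hausdorff_gauge s (U n))" .
    qed (use that in auto)
    have le: "hausdorff_premeasure t \<epsilon> E \<le> ennreal (\<epsilon> powr (t - s)) * hausdorff_outer_measure s E"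
      if "0 < \<epsilon>" for \<epsilon>
      by (rule order_trans[OF pre[OF that]])
        (intro mult_left_mono hausdorff_premeasure_le_outer that, simp)
    obtain h where h: "hausdorff_outer_measure s E = ennreal h" "h \<ge> 0"
      using fin by (cases "hausdorff_outer_measure s E") auto
    have "hausdorff_premeasure t \<epsilon> E \<le> 0" if "\<epsilon> > 0" for \<epsilon>
    proof (rule ennreal_le_epsilon)
      fix e :: real assume "e > 0"
      \<comment> \<open>the mesh at which the bound of the previous step drops below \<open>e\<close>\<close>
      define \<delta> where "\<delta> = min \<epsilon> ((e / (h + 1)) powr (1 / (t - s)))"
      have \<delta>: "\<delta> > 0" "\<delta> \<le> \<epsilon>" using \<open>\<epsilon> > 0\<close> \<open>e > 0\<close> h by (auto simp: \<delta>_def)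
      have "\<delta> powr (t - s) \<le> ((e / (h + 1)) powr (1 / (t - s))) powr (t - s)"
        using \<delta> \<open>t > s\<close> by (intro powr_mono2) (auto simp: \<delta>_def)
      also have "\<dots> = e / (h + 1)"
        using \<open>t > s\<close> \<open>e > 0\<close> h by (simp add: powr_powr)
      finally have "\<delta> powr (t - s) * h \<le> e / (h + 1) * h"
        using h by (intro mult_right_mono)
      also have "\<dots> \<le> e" using h \<open>e > 0\<close> by (simp add: field_simps)
      finally have *: "\<delta> powr (t - s) * h \<le> e" .
      have "hausdorff_premeasure t \<epsilon> E \<le> hausdorff_premeasure t \<delta> E"
        by (rule hausdorff_premeasure_antimono) fact
      also have "\<dots> \<le> ennreal (\<delta> powr (t - s)) * ennreal h"
        using le[OF \<delta>(1)] h by simp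
      also have "\<dots> \<le> ennreal e" using * h by (simp add: ennreal_leI flip: ennreal_mult)
      finally show "hausdorff_premeasure t \<epsilon> E \<le> 0 + ennreal e" by simp
    qed
    then have "hausdorff_outer_measure t E \<le> 0" by (rule hausdorff_outer_measure_least)
    then show ?thesis by simp
  qed
  show "hausdorff_dim E \<le> ereal s"
  proof (rule ereal_le_epsilon2)
    fix e :: real assume "0 < e"
    then show "hausdorff_dim E \<le> ereal s + ereal e"
      unfolding hausdorff_dim_def using null[of "s + e"] s by (intro INF_lower2[of "s + e"]) auto
  qed
  have ge: "hausdorff_outer_measure s E \<le> hausdorff_outer_measure t E" if t: "0 \<le> t" "t < s" for t
  proof (rule hausdorff_outer_measure_least)
    fix \<epsilon> :: real assume "\<epsilon> > 0"
    have "hausdorff_premeasure s \<epsilon> E \<le> hausdorff_premeasure s (min \<epsilon> 1) E"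
      by (rule hausdorff_premeasure_antimono) simp
    also have "\<dots> \<le> hausdorff_premeasure t (min \<epsilon> 1) E"
      unfolding hausdorff_premeasure_def
    proof (intro INF_mono bexI suminf_le allI)
      fix U :: "nat \<Rightarrow> 'a set" and n
      assume "U \<in> {U. E \<subseteq> \<Union> (range U) \<and> (\<forall>n. bounded (U n) \<and> diameter (U n) \<le> min \<epsilon> 1)}"
      then have "bounded (U n)" "diameter (U n) \<le> 1" by auto
      then show "hausdorff_gauge s (U n) \<le> hausdorff_gauge t (U n)"
        using t diameter_ge_0[of "U n"] 
        by (auto simp: hausdorff_gauge_def powr_le1 intro!: ennreal_leI powr_mono')
    qed auto
    also have "\<dots> \<le> hausdorff_outer_measure t E"
      using \<open>\<epsilon> > 0\<close> by (intro hausdorff_premeasure_le_outer) auto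
    finally show "hausdorff_premeasure s \<epsilon> E \<le> hausdorff_outer_measure t E" .
  qed
  show "ereal s \<le> hausdorff_dim E"
    unfolding hausdorff_dim_def
  proof (rule INF_greatest)
    fix t assume "t \<in> {t. 0 \<le> t \<and> hausdorff_outer_measure t E = 0}"
    then show "ereal s \<le> ereal t" using ge[of t] pos by (cases "t < s") auto
  qed
qed

section \<open>Perron--Frobenius theory of a primitive matrix\<close>

lemma mult_mat_vec_sum:
  assumes "A \<in> carrier_mat n n" "x \<in> carrier_vec n" "i < n"
  shows "(A *\<^sub>v x) $ i = (\<Sum>j<n. A $$ (i, j) * x $ j)"
  using assms by (auto simp: scalar_prod_def lessThan_atLeast0 intro!: sum.cong)

lemma pow_mat_Suc_left:
  assumes "A \<in> carrier_mat n n"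
  shows "A ^\<^sub>m Suc k = A * A ^\<^sub>m k"
proof (induction k)
  case 0
  then show ?case using assms by auto
next
  case (Suc k)
  have "A ^\<^sub>m Suc (Suc k) = (A * A ^\<^sub>m k) * A" using Suc by simp
  also have "\<dots> = A * (A ^\<^sub>m k * A)" using assms by (intro assoc_mult_mat) auto
  finally show ?case by simp
qed

lemma pow_smult_mat:
  fixes A :: "'a::comm_semiring_1 mat"
  assumes A: "A \<in> carrier_mat n n"
  shows "(c \<cdot>\<^sub>m A) ^\<^sub>m k = c ^ k \<cdot>\<^sub>m (A ^\<^sub>m k)"
proof (induction k)
  case 0
  then show ?case using A by (intro eq_matI) auto
next
  case (Suc k)
  have "(c \<cdot>\<^sub>m A) ^\<^sub>m Suc k = (c ^ k \<cdot>\<^sub>m A ^\<^sub>m k) * (c \<cdot>\<^sub>m A)" using Suc by simp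
  also have "\<dots> = c \<cdot>\<^sub>m ((c ^ k \<cdot>\<^sub>m A ^\<^sub>m k) * A)"
    using A by (intro mult_smult_distrib[of _ n n]) auto
  also have "(c ^ k \<cdot>\<^sub>m A ^\<^sub>m k) * A = c ^ k \<cdot>\<^sub>m (A ^\<^sub>m k * A)"
    using A by (intro mult_smult_assoc_mat[of _ n n]) auto
  finally show ?case using A by (intro eq_matI) (auto simp: mult.assoc)
qed

lemma eigenvector_of_smult_mat:
  fixes A :: "complex mat"
  assumes A: "A \<in> carrier_mat n n" and c: "c \<noteq> 0" and ev: "eigenvector (c \<cdot>\<^sub>m A) v k"
  shows "eigenvector A v (k / c)"
proof -
  have v: "v \<in> carrier_vec n" "v \<noteq> 0\<^sub>v n" "(c \<cdot>\<^sub>m A) *\<^sub>v v = k \<cdot>\<^sub>v v"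
    using ev A by (auto simp: eigenvector_def)
  have "c * (A *\<^sub>v v) $ i = k * v $ i" if "i < n" for i
  proof -
    have "((c \<cdot>\<^sub>m A) *\<^sub>v v) $ i = (k \<cdot>\<^sub>v v) $ i" using v by simp
    then show ?thesis using that A v
      by (subst (asm) mult_mat_vec_sum[of _ n], simp, simp, simp)
         (subst mult_mat_vec_sum[of _ n], auto simp: sum_distrib_left mult.assoc)
  qed
  then have "A *\<^sub>v v = (k / c) \<cdot>\<^sub>v v"
    using A v c by (intro eq_vecI) (auto simp: field_simps simp del: index_mult_mat_vec)
  then show ?thesis using A v by (auto simp: eigenvector_def)
qed

lemma pow_mat_le_of_spectral_radius_less:
  fixes A :: "real mat"
  assumes A: "A \<in> carrier_mat n n" and n: "n > 0" and t: "t > 0"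
    and less: "spectral_radius (map_mat complex_of_real A) < t"
  obtains c where "\<And>k i j. i < n \<Longrightarrow> j < n \<Longrightarrow> \<bar>(A ^\<^sub>m k) $$ (i, j)\<bar> \<le> c * t ^ k"
proof -
  let ?C = "map_mat complex_of_real A"
  let ?B = "complex_of_real (1/t) \<cdot>\<^sub>m ?C"
  have C: "?C \<in> carrier_mat n n" and B: "?B \<in> carrier_mat n n" using A by auto
  obtain k where k: "k \<in> spectrum ?B" "spectral_radius ?B = norm k"
    using spectral_radius_mem_max(1)[OF B n] by auto
  then obtain v where "eigenvector ?B v k"
    by (auto simp: spectrum_def eigenvalue_def)
  then have "eigenvector ?C v (k / complex_of_real (1/t))"
    using t C by (intro eigenvector_of_smult_mat) auto
  then have "norm (k / complex_of_real (1/t)) \<le> spectral_radius ?C"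
    by (intro spectral_radius_mem_max(2)[OF C n] imageI) (auto simp: spectrum_def eigenvalue_def)
  then have "norm k * t \<le> spectral_radius ?C"
    using t by (simp add: norm_divide norm_mult)
  then have "spectral_radius ?B < 1"
    using less t k 
    by (metis le_less_trans mult_1 mult_less_cancel_right_pos)
  then obtain c where c: "\<And>k. norm_bound (?B ^\<^sub>m k) c"
    using spectral_radius_jnf_norm_bound_less_1_upper_triangular[OF B] by auto
  show ?thesis
  proof
    fix k i j assume ij: "i < n" "j < n"
    have "?C ^\<^sub>m k = map_mat complex_of_real (A ^\<^sub>m k)"
      using of_real_hom.mat_hom_pow[OF A] by metis
    then have "norm ((complex_of_real (1/t)) ^ k * complex_of_real ((A ^\<^sub>m k) $$ (i,j))) \<le> c"
      using c[of k] ij A by (simp add: pow_smult_mat[OF C] norm_bound_def)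
    then show "\<bar>(A ^\<^sub>m k) $$ (i, j)\<bar> \<le> c * t ^ k"
      using t by (simp add: norm_mult norm_power field_simps norm_divide)
  qed
qed

text \<open>A nonnegative square matrix with a positive power.  The exponent \<open>m\<close> must not be \<open>0\<close>: otherwise the zero matrix of size \<open>1\<close> would qualify, and its
  spectral radius is not positive.\<close>

locale primitive_matrix =
  fixes A :: "real mat" and N m :: nat
  assumes A: "A \<in> carrier_mat N N" and N_pos: "N > 0" and m_pos: "m > 0"
    and nonneg: "\<And>i j. i < N \<Longrightarrow> j < N \<Longrightarrow> 0 \<le> A $$ (i, j)"
    and pow_pos: "\<And>i j. i < N \<Longrightarrow> j < N \<Longrightarrow> 0 < (A ^\<^sub>m m) $$ (i, j)"
begin

abbreviation r :: real where "r \<equiv> perron_root A"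

lemma dim_A [simp]: "dim_row A = N" "dim_col A = N"
  using A by auto

lemma pow_carrier [simp]: "A ^\<^sub>m k \<in> carrier_mat N N"
  using A by simp

lemma pow_mult_mat_vec_pos:
  assumes x: "x \<in> carrier_vec N" "\<And>i. i < N \<Longrightarrow> 0 \<le> x $ i" "x \<noteq> 0\<^sub>v N" and i: "i < N"
  shows "0 < (A ^\<^sub>m m *\<^sub>v x) $ i"
proof -
  obtain j where j: "j < N" "x $ j \<noteq> 0"
    using x by (metis carrier_vecD eq_vecI index_zero_vec)
  show ?thesis
    unfolding mult_mat_vec_sum[OF pow_carrier x(1) i]
    using x(2) j pow_pos[OF i] by (intro sum_pos2[of _ j])
      (auto intro!: mult_pos_pos mult_nonneg_nonneg simp: less_le)
qed

lemma mult_mat_vec_mono: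
  assumes "x \<in> carrier_vec N" "y \<in> carrier_vec N" "\<And>i. i < N \<Longrightarrow> x $ i \<le> y $ i" "i < N"
  shows "(A *\<^sub>v x) $ i \<le> (A *\<^sub>v y) $ i"
  using assms nonneg by (auto simp: mult_mat_vec_sum[OF A] simp del: index_mult_mat_vec intro!: sum_mono mult_left_mono)

text \<open>The growth of the powers of \<open>A\<close> bounds every positive number \<open>t\<close> for which some positive
  vector satisfies \<open>t y \<le> A y\<close> (the Collatz--Wielandt bound).\<close>

lemma collatz_wielandt_le:
  assumes y: "y \<in> carrier_vec N" "\<And>i. i < N \<Longrightarrow> 0 < y $ i" and t: "t > 0"
    and le: "\<And>i. i < N \<Longrightarrow> t * y $ i \<le> (A *\<^sub>v y) $ i"
  shows "t \<le> r"
proof (rule ccontr)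
  assume "\<not> t \<le> r"
  then have rt: "r < t" by simp
  \<comment> \<open>a positive number strictly between \<open>r\<close> and \<open>t\<close>\<close>
  define u where "u = max (t/2) ((r + t) / 2)"
  have u: "r < u" "u < t" "0 < u" using rt t by (simp_all add: u_def less_max_iff_disj)
  obtain c where c: "\<And>k i j. i < N \<Longrightarrow> j < N \<Longrightarrow> \<bar>(A ^\<^sub>m k) $$ (i, j)\<bar> \<le> c * u ^ k"
    using pow_mat_le_of_spectral_radius_less[OF A N_pos u(3) u(1)] by blast
  have grow: "t ^ k * y $ i \<le> (A ^\<^sub>m k *\<^sub>v y) $ i" if "i < N" for k i
    using that
  proof (induction k arbitrary: i)
    case 0
    then show ?case using y by simp
  next
    case (Suc k)
    have "t ^ Suc k * y $ i = t ^ k * (t * y $ i)" by simp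
    also have "\<dots> \<le> t ^ k * (A *\<^sub>v y) $ i" using le[OF Suc.prems] t by (intro mult_left_mono) auto
    also have "\<dots> = (A *\<^sub>v (t ^ k \<cdot>\<^sub>v y)) $ i"
      using y Suc.prems A by (simp add: mult_mat_vec[OF A y(1)] del: index_mult_mat_vec)
    also have "\<dots> \<le> (A *\<^sub>v (A ^\<^sub>m k *\<^sub>v y)) $ i"
    proof (rule mult_mat_vec_mono)
      show "(t ^ k \<cdot>\<^sub>v y) $ j \<le> (A ^\<^sub>m k *\<^sub>v y) $ j" if "j < N" for j
        using Suc.IH[OF that] y that by simp
    qed (use y Suc.prems in \<open>auto intro!: mult_mat_vec_carrier[OF pow_carrier]\<close>)
    also have "A *\<^sub>v (A ^\<^sub>m k *\<^sub>v y) = A ^\<^sub>m Suc k *\<^sub>v y"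
      unfolding pow_mat_Suc_left[OF A] using A y by (intro assoc_mult_mat_vec[symmetric]) auto
    finally show ?case .
  qed
  define Y where "Y = (\<Sum>j<N. y $ j)"
  have bound: "(t / u) ^ k * y $ 0 \<le> c * Y" for k
  proof -
    have "t ^ k * y $ 0 \<le> (\<Sum>j<N. (A ^\<^sub>m k) $$ (0, j) * y $ j)"
      using grow[OF N_pos, of k] mult_mat_vec_sum[OF pow_carrier y(1) N_pos] by simp
    also have "\<dots> \<le> (\<Sum>j<N. c * u ^ k * y $ j)"
      using c[OF N_pos, of _ k] y(2) by (intro sum_mono mult_right_mono) (auto intro: less_imp_le order_trans[OF abs_ge_self])
    also have "\<dots> = u ^ k * (c * Y)" by (simp add: Y_def sum_distrib_left mult_ac)
    finally have "t ^ k * y $ 0 / u ^ k \<le> c * Y" using u by (simp add: field_simps)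
    then show ?thesis by (simp add: power_divide)
  qed
  have "1 < t / u" using u by simp
  then obtain k where "c * Y / y $ 0 < (t / u) ^ k"
    using real_arch_pow by blast
  then show False using bound[of k] y(2)[OF N_pos] by (simp add: field_simps)
qed

text \<open>The absolute values of an eigenvector for an eigenvalue of modulus \<open>r\<close> form a vector
  \<open>x\<close> with \<open>r x \<le> A x\<close>.  If this were not an equality, multiplication by \<open>A\<^sup>m\<close> would
  make the inequality strict in every coordinate, and some \<open>t > r\<close> would
  contradict the Collatz--Wielandt bound.\<close>

lemma perron_vector_exists: "\<exists>p. perron_frobenius_vector A p"
proof -
  let ?C = "map_mat complex_of_real A"
  have C: "?C \<in> carrier_mat N N" using A by simp
  obtain k z where k: "norm k = r" "eigenvector ?C z k"
    using spectral_radius_mem_max(1)[OF C N_pos] by (auto simp: spectrum_def eigenvalue_def)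
  then have z: "z \<in> carrier_vec N" "z \<noteq> 0\<^sub>v N" "?C *\<^sub>v z = k \<cdot>\<^sub>v z"
    by (auto simp: eigenvector_def)
  define x where "x = vec N (\<lambda>i. norm (z $ i))"
  have x: "x \<in> carrier_vec N" "\<And>i. i < N \<Longrightarrow> 0 \<le> x $ i" by (auto simp: x_def)
  obtain j where j: "j < N" "z $ j \<noteq> 0"
    using z by (metis carrier_vecD eq_vecI index_zero_vec)
  then have x0: "x \<noteq> 0\<^sub>v N" by (metis index_vec index_zero_vec(1) norm_eq_zero x_def)
  have r0: "r \<ge> 0" using k by (metis norm_ge_zero)
  have sub: "r * x $ i \<le> (A *\<^sub>v x) $ i" if i: "i < N" for i
  proof -
    have "r * x $ i = norm ((?C *\<^sub>v z) $ i)"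
      using i z k by (simp add: x_def norm_mult)
    also have "\<dots> \<le> (\<Sum>j<N. norm (?C $$ (i, j) * z $ j))"
      unfolding mult_mat_vec_sum[OF C z(1) i] by (rule norm_sum)
    also have "\<dots> = (A *\<^sub>v x) $ i"
      unfolding mult_mat_vec_sum[OF A x(1) i] using i nonneg
      by (intro sum.cong) (auto simp: x_def norm_mult)
    finally show ?thesis .
  qed
  define w where "w = A *\<^sub>v x - r \<cdot>\<^sub>v x"
  have w: "w \<in> carrier_vec N" "\<And>i. i < N \<Longrightarrow> 0 \<le> w $ i"
    using sub x A by (auto simp: w_def simp del: index_mult_mat_vec)
  have "w = 0\<^sub>v N"
  proof (rule ccontr)
    assume "w \<noteq> 0\<^sub>v N"
    define y where "y = A ^\<^sub>m m *\<^sub>v x"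
    have y: "y \<in> carrier_vec N" "\<And>i. i < N \<Longrightarrow> 0 < y $ i"
      using pow_mult_mat_vec_pos[OF x x0] mult_mat_vec_carrier[OF pow_carrier x(1)]
      by (auto simp: y_def simp del: index_mult_mat_vec)
    have "A *\<^sub>v y = A ^\<^sub>m m *\<^sub>v (A *\<^sub>v x)"
    proof -
      have "A *\<^sub>v y = A ^\<^sub>m Suc m *\<^sub>v x"
        unfolding y_def pow_mat_Suc_left[OF A] using A x by (intro assoc_mult_mat_vec[symmetric]) auto
      also have "\<dots> = A ^\<^sub>m m *\<^sub>v (A *\<^sub>v x)"
        using assoc_mult_mat_vec[OF pow_carrier A x(1), of m] by simp
      finally show ?thesis .
    qed
    moreover have "A ^\<^sub>m m *\<^sub>v w = A ^\<^sub>m m *\<^sub>v (A *\<^sub>v x) - A ^\<^sub>m m *\<^sub>v (r \<cdot>\<^sub>v x)"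
      unfolding w_def using A x by (intro mult_minus_distrib_mat_vec[OF pow_carrier]) auto
    moreover have "A ^\<^sub>m m *\<^sub>v (r \<cdot>\<^sub>v x) = r \<cdot>\<^sub>v y"
      unfolding y_def by (rule mult_mat_vec[OF pow_carrier x(1)])
    ultimately have "(A ^\<^sub>m m *\<^sub>v w) $ i = (A *\<^sub>v y) $ i - r * y $ i" if "i < N" for i
      using that y by (simp del: index_mult_mat_vec)
    with pow_mult_mat_vec_pos[OF w \<open>w \<noteq> 0\<^sub>v N\<close>]
    have gt: "r * y $ i < (A *\<^sub>v y) $ i" if "i < N" for i
      using that by fastforce
    define t where "t = Min ((\<lambda>i. (A *\<^sub>v y) $ i / y $ i) ` {..<N})"
    have "t \<in> (\<lambda>i. (A *\<^sub>v y) $ i / y $ i) ` {..<N}"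
      unfolding t_def using N_pos by (intro Min_in) auto
    then have "r < t" using gt y by (auto simp: field_simps simp del: index_mult_mat_vec)
    have "t * y $ i \<le> (A *\<^sub>v y) $ i" if "i < N" for i
    proof -
      have "t \<le> (A *\<^sub>v y) $ i / y $ i"
        unfolding t_def using that by (intro Min_le) auto
      then show ?thesis using y(2)[OF that] by (simp add: field_simps)
    qed
    then have "t \<le> r" using \<open>r < t\<close> r0 by (intro collatz_wielandt_le[OF y]) auto
    with \<open>r < t\<close> show False by simp
  qed
  then have Ax: "(A *\<^sub>v x) $ i = r * x $ i" if "i < N" for i
    proof -
    have "w $ i = 0" using \<open>w = 0\<^sub>v N\<close> that by simp
    then show ?thesis using that x by (simp add: w_def del: index_mult_mat_vec)
  qed
  define S where "S = (\<Sum>i<N. x $ i)"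
  have "S > 0" unfolding S_def using j x
    by (intro sum_pos2[of _ j]) (auto simp: x_def)
  define p where "p = (1/S) \<cdot>\<^sub>v x"
  have "A *\<^sub>v p = r \<cdot>\<^sub>v p"
    unfolding p_def mult_mat_vec[OF A x(1)]
    using x A Ax by (intro eq_vecI) (auto simp del: index_mult_mat_vec)
  moreover have "(\<Sum>i<N. p $ i) = 1"
    using \<open>S > 0\<close> x(1) by (simp add: p_def flip: sum_divide_distrib) (simp add: S_def)
  moreover have "p \<noteq> 0\<^sub>v N" using calculation(2) by (auto)
  ultimately show ?thesis
    using x \<open>S > 0\<close> unfolding perron_frobenius_vector_def eigenvector_def
    by (intro exI[of _ p]) (auto simp: p_def simp del: index_mult_mat_vec)
qed

lemma
  assumes "perron_frobenius_vector A p"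
  shows perron_vector_carrier: "p \<in> carrier_vec N"
    and perron_vector_eq: "i < N \<Longrightarrow> (\<Sum>j<N. A $$ (i, j) * p $ j) = r * p $ i"
    and perron_vector_pow: "(A ^\<^sub>m k) *\<^sub>v p = r ^ k \<cdot>\<^sub>v p"
    and perron_root_pos: "0 < r"
    and perron_vector_pos: "i < N \<Longrightarrow> 0 < p $ i"
    and perron_vector_sum: "(\<Sum>i<N. p $ i) = 1"
proof -
  have ev: "eigenvector A p r" and p0: "\<And>i. i < N \<Longrightarrow> 0 \<le> p $ i" and sum: "(\<Sum>i<N. p $ i) = 1"
    using assms by (auto simp: perron_frobenius_vector_def)
  then have p: "p \<in> carrier_vec N" "p \<noteq> 0\<^sub>v N" "A *\<^sub>v p = r \<cdot>\<^sub>v p"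
    by (auto simp: eigenvector_def)
  show "p \<in> carrier_vec N" "(\<Sum>i<N. p $ i) = 1" by fact+
  show "(\<Sum>j<N. A $$ (i, j) * p $ j) = r * p $ i" if "i < N"
    using mult_mat_vec_sum[OF A p(1) that] that p by (simp del: index_mult_mat_vec)
  have pow: "(A ^\<^sub>m k) *\<^sub>v p = r ^ k \<cdot>\<^sub>v p" for k
    by (rule eigenvector_pow[OF A ev])
  then show "(A ^\<^sub>m k) *\<^sub>v p = r ^ k \<cdot>\<^sub>v p" .
  have pos: "0 < r ^ m * p $ i" if "i < N" for i
    using pow_mult_mat_vec_pos[OF p(1) p0 p(2) that] pow that p(1) by (simp del: index_mult_mat_vec)
  show "0 < p $ i" if "i < N" using pos[OF that] p0[OF that] by (metis less_le mult_zero_right)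
  have "spectral_radius (map_mat complex_of_real A) \<ge> 0"
  proof -
    have "map_mat complex_of_real A \<in> carrier_mat N N" using A by simp
    from spectral_radius_mem_max(1)[OF this N_pos] show ?thesis by auto
  qed
  moreover have "r \<noteq> 0" using pos[OF N_pos] m_pos by (auto simp: zero_power)
  ultimately show "0 < r" by simp
qed

text \<open>Subtracting from \<open>q\<close> the largest multiple of \<open>p\<close> that keeps it nonnegative produces a zero
  coordinate.  A nonzero nonnegative eigenvector has none, because \<open>A\<^sup>m\<close> makes all coordinates
  positive.\<close>

lemma perron_vector_unique:
  assumes p: "perron_frobenius_vector A p" and q: "perron_frobenius_vector A q"
  shows "q = p"
proof -
  note pc = perron_vector_carrier[OF p] and qc = perron_vector_carrier[OF q]
  note p_pos = perron_vector_pos[OF p]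
  define t where "t = Min ((\<lambda>i. q $ i / p $ i) ` {..<N})"
  have "t \<in> (\<lambda>i. q $ i / p $ i) ` {..<N}"
    unfolding t_def using N_pos by (intro Min_in) auto
  then obtain i where i: "i < N" "t = q $ i / p $ i" by auto
  define x where "x = q - t \<cdot>\<^sub>v p"
  have x: "x \<in> carrier_vec N" using pc qc by (simp add: x_def)
  have x0: "0 \<le> x $ j" if "j < N" for j
  proof -
    have "t \<le> q $ j / p $ j"
      unfolding t_def using that by (intro Min_le) auto
    then show ?thesis using p_pos[OF that] pc qc that by (simp add: x_def field_simps)
  qed
  have "x $ i = 0" using i p_pos[OF i(1)] pc qc by (simp add: x_def)
  have "(A ^\<^sub>m m) *\<^sub>v x = r ^ m \<cdot>\<^sub>v x"
  proof -
    have "(A ^\<^sub>m m) *\<^sub>v x = r ^ m \<cdot>\<^sub>v q - t \<cdot>\<^sub>v (r ^ m \<cdot>\<^sub>v p)"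
      unfolding x_def using pc qc
      by (simp add: mult_minus_distrib_mat_vec[OF pow_carrier] mult_mat_vec[OF pow_carrier]
          perron_vector_pow[OF p] perron_vector_pow[OF q])
    then show ?thesis using pc qc by (intro eq_vecI) (auto simp: x_def algebra_simps)
  qed
  then have "((A ^\<^sub>m m) *\<^sub>v x) $ i = 0"
    using \<open>x $ i = 0\<close> i x by simp
  then have "x = 0\<^sub>v N"
    using pow_mult_mat_vec_pos[OF x x0 _ i(1)] by (metis less_irrefl)
  then have eq: "q $ j = t * p $ j" if "j < N" for j
  proof -
    have "x $ j = 0" using \<open>x = 0\<^sub>v N\<close> that by simp
    then show ?thesis using that pc qc by (simp add: x_def)
  qed
  have "1 = t * (\<Sum>j<N. p $ j)"
    unfolding sum_distrib_left perron_vector_sum[OF q, symmetric] by (intro sum.cong) (auto simp: eq)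
  then have "t = 1" by (simp add: perron_vector_sum[OF p])
  then show ?thesis using eq pc qc by (intro eq_vecI) auto
qed

end

section \<open>Digit expansions\<close>

text \<open>\<open>code N n x\<close> is the integer whose base-\<open>N\<close> digits are the first \<open>n\<close> terms of \<open>x\<close>.  For
  sequences of digits it determines these \<open>n\<close> terms, so that the sets on which it is constant
  are the cylinder sets of level \<open>n\<close>.\<close>

primrec code :: "nat \<Rightarrow> nat \<Rightarrow> (nat \<Rightarrow> nat) \<Rightarrow> nat" where
  "code N 0 x = 0"
| "code N (Suc n) x = N * code N n x + x n"

lemma code_add:
  assumes "\<And>n. x n < N"
  shows "code N n x * N ^ k \<le> code N (n + k) x \<and> code N (n + k) x < (code N n x + 1) * N ^ k"
proof (induction k)
  case (Suc k)
  have 1: "(code N (n + k) x + 1) * N \<le> (code N n x + 1) * N ^ k * N"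
    using Suc by (intro mult_right_mono) auto
  have 2: "code N n x * N ^ k * N \<le> code N (n + k) x * N"
    using Suc by (intro mult_right_mono) auto
  have "code N n x * N ^ Suc k \<le> code N (n + Suc k) x"
    using trans_le_add1[OF 2, of "x (n + k)"] by (simp only: code.simps power_Suc add_Suc_right mult_ac)
  moreover have "code N (n + Suc k) x < (code N (n + k) x + 1) * N"
    using assms[of "n + k"] by simp
  with 1 have "code N (n + Suc k) x < (code N n x + 1) * N ^ Suc k"
    by (simp only: power_Suc mult_ac)
  ultimately show ?case by blast
qed simp

lemma expansion_value_summable:
  assumes "N \<ge> 2" "\<And>n. x n < N"
  shows "summable (\<lambda>n. real (x n) / real N ^ Suc n)"
proof (rule summable_comparison_test')
  show "summable (\<lambda>n. (1 / real N) ^ n)"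
    using assms by (intro summable_geometric) auto
  show "norm (real (x n) / real N ^ Suc n) \<le> (1 / real N) ^ n" if "n \<ge> 0" for n
    using assms(1) assms(2)[of n] by (auto simp: power_divide field_simps)
qed

lemma expansion_value_nonneg:
  assumes "N \<ge> 2" "\<And>n. x n < N"
  shows "0 \<le> expansion_value N x"
  unfolding expansion_value_def by (intro suminf_nonneg expansion_value_summable assms) auto

lemma expansion_value_le_1:
  assumes "N \<ge> 2" "\<And>n. x n < N"
  shows "expansion_value N x \<le> 1"
proof -
  have g: "(\<lambda>n. (real N - 1) / real N * (1 / real N) ^ n) sums ((real N - 1) / real N * (1 / (1 - 1 / real N)))"
    using assms by (intro sums_mult geometric_sums) auto
  have "expansion_value N x \<le> (\<Sum>n. (real N - 1) / real N * (1 / real N) ^ n)"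
    unfolding expansion_value_def
  proof (rule suminf_le)
    show "real (x n) / real N ^ Suc n \<le> (real N - 1) / real N * (1 / real N) ^ n" for n
      using assms(1) assms(2)[of n] by (auto simp: power_divide field_simps)
    show "summable (\<lambda>n. (real N - 1) / real N * (1 / real N) ^ n)"
      using g by (rule sums_summable)
  qed (rule expansion_value_summable[OF assms])
  also have "\<dots> = 1" using g assms by (simp add: sums_iff field_simps)
  finally show ?thesis .
qed

lemma expansion_value_Suc:
  assumes "N \<ge> 2" "\<And>n. x n < N"
  shows "expansion_value N x = (real (x 0) + expansion_value N (\<lambda>k. x (Suc k))) / real N"
proof -
  have sm: "summable (\<lambda>n. real (x n) / real N ^ Suc n)"
    by (rule expansion_value_summable[OF assms])
  have "expansion_value N x = real (x 0) / real N ^ Suc 0 + (\<Sum>n. real (x (Suc n)) / real N ^ Suc (Suc n))"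
    unfolding expansion_value_def suminf_split_head[OF sm] by simp
  also have "(\<Sum>n. real (x (Suc n)) / real N ^ Suc (Suc n)) = (\<Sum>n. real (x (Suc n)) / real N ^ Suc n / real N)"
    by (simp add: mult.commute)
  also have "\<dots> = expansion_value N (\<lambda>k. x (Suc k)) / real N"
    unfolding expansion_value_def using assms
    by (intro suminf_divide expansion_value_summable) auto
  finally show ?thesis by (simp add: add_divide_distrib)
qed

lemma expansion_value_split:
  assumes "N \<ge> 2" "\<And>n. x n < N"
  shows "expansion_value N x = real (code N n x) / real N ^ n + 1 / real N ^ n * expansion_value N (\<lambda>k. x (n + k))"
proof (induction n)
  case (Suc n)
  have "expansion_value N (\<lambda>k. x (n + k)) = (real (x n) + expansion_value N (\<lambda>k. x (Suc n + k))) / real N"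
    using expansion_value_Suc[of N "\<lambda>k. x (n + k)"] assms by simp
  then show ?case using Suc assms(1) by (simp add: field_simps)
qed simp

lemma expansion_value_code_bounds:
  assumes "N \<ge> 2" "\<And>n. x n < N"
  shows "real (code N n x) \<le> real N ^ n * expansion_value N x"
    "real N ^ n * expansion_value N x \<le> real (code N n x) + 1"
  using expansion_value_split[where n = n and x = x, OF assms] assms
    expansion_value_nonneg[of N "\<lambda>k. x (n + k)"] expansion_value_le_1[of N "\<lambda>k. x (n + k)"]
  by (auto simp: field_simps)

section \<open>The Hausdorff measure of the limit set is positive and finite\<close>

text \<open>A primitive matrix of zeros and ones with unit diagonal and at least two digits.\<close>

locale limit_set = primitive_matrix +
  assumes N_ge_2: "N \<ge> 2"
    and zero_one: "\<And>i j. i < N \<Longrightarrow> j < N \<Longrightarrow> A $$ (i, j) = 0 \<or> A $$ (i, j) = 1"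
    and diag: "\<And>i. i < N \<Longrightarrow> A $$ (i, i) = 1"
begin

abbreviation val :: "(nat \<Rightarrow> nat) \<Rightarrow> real" where "val \<equiv> expansion_value N"

text \<open>The Perron--Frobenius vector of \<open>A\<close>, normalized to have sum \<open>1\<close>.\<close>

definition p :: "real Matrix.vec" where "p = (SOME p. perron_frobenius_vector A p)"

text \<open>This exponent turns out to be the Hausdorff dimension.\<close>

definition s :: real where "s = ln r / ln (real N)"

lemma p: "perron_frobenius_vector A p"
  unfolding p_def by (rule someI_ex[OF perron_vector_exists])

lemmas p_pos = perron_vector_pos[OF p] and p_sum = perron_vector_sum[OF p]
  and p_eq = perron_vector_eq[OF p] and r_pos = perron_root_pos[OF p]

lemma p_le_1: "i < N \<Longrightarrow> p $ i \<le> 1"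
  using member_le_sum[of i "{..<N}" "\<lambda>i. p $ i"] p_sum p_pos by (auto intro: less_imp_le)

lemma p_admissible_sum: "i < N \<Longrightarrow> (\<Sum>j | j < N \<and> A $$ (i, j) = 1. p $ j) = r * p $ i"
  unfolding p_eq[symmetric] using zero_one
  by (intro sum.mono_neutral_cong_left) auto

text \<open>The first row of \<open>A\<^sup>m\<close> has a diagonal entry at least \<open>1\<close>, by the unit diagonal of \<open>A\<close>, and a
  positive second entry.  Hence \<open>r\<^sup>m p\<^sub>0 > p\<^sub>0\<close>.\<close>

lemma r_gt_1: "r > 1"
proof -
  have "(A ^\<^sub>m k) $$ (0, 0) \<ge> 1 \<and> (\<forall>i<N. \<forall>j<N. (A ^\<^sub>m k) $$ (i, j) \<ge> 0)" for k
  proof (induction k)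
    case (Suc k)
    have e: "(A ^\<^sub>m Suc k) $$ (i, j) = (\<Sum>l<N. (A ^\<^sub>m k) $$ (i, l) * A $$ (l, j))" if "i < N" "j < N" for i j
      using that by (auto simp: scalar_prod_def lessThan_atLeast0 intro!: sum.cong)
    have "1 \<le> (A ^\<^sub>m k) $$ (0, 0) * A $$ (0, 0)" using Suc diag N_pos by simp
    also have "\<dots> \<le> (\<Sum>l<N. (A ^\<^sub>m k) $$ (0, l) * A $$ (l, 0))"
      using Suc nonneg N_pos by (intro member_le_sum) auto
    finally show ?case using Suc nonneg N_pos by (auto simp: e simp del: pow_mat.simps intro!: sum_nonneg)
  qed (use N_pos in auto)
  then have ge: "(A ^\<^sub>m m) $$ (0, 0) \<ge> 1" by blast
  have "p $ 0 < (A ^\<^sub>m m) $$ (0, 0) * p $ 0 + (A ^\<^sub>m m) $$ (0, 1) * p $ 1"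
  proof -
    have "0 < (A ^\<^sub>m m) $$ (0, 1) * p $ 1"
      using pow_pos p_pos N_ge_2 by (intro mult_pos_pos) auto
    moreover have "1 * p $ 0 \<le> (A ^\<^sub>m m) $$ (0, 0) * p $ 0"
      using ge p_pos[of 0] N_pos by (intro mult_right_mono) auto
    ultimately show ?thesis by linarith
  qed
  also have "\<dots> = (\<Sum>j\<in>{0,1}. (A ^\<^sub>m m) $$ (0, j) * p $ j)" by simp
  also have "\<dots> \<le> (\<Sum>j<N. (A ^\<^sub>m m) $$ (0, j) * p $ j)"
    using N_ge_2 pow_pos p_pos N_pos by (intro sum_mono2) (auto intro: less_imp_le)
  also have "\<dots> = r ^ m * p $ 0"
    using mult_mat_vec_sum[OF pow_carrier perron_vector_carrier[OF p] N_pos, of m]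
      perron_vector_pow[OF p, of m] N_pos perron_vector_carrier[OF p] by (simp del: index_mult_mat_vec)
  finally have "1 < r ^ m" using p_pos[OF N_pos] by simp
  then show ?thesis using r_pos by (metis linorder_not_less power_le_one less_imp_le)
qed

lemma s_pos: "s > 0"
  unfolding s_def using r_gt_1 N_ge_2 by (intro divide_pos_pos) auto

lemma N_powr_s: "real N powr s = r"
  using N_ge_2 r_pos by (simp add: s_def powr_def)

lemma power_powr_s: "(real N ^ k) powr s = r ^ k"
  using N_ge_2 by (induction k) (auto simp: powr_mult N_powr_s)

lemma LambdaD: "x \<in> Lambda A \<Longrightarrow> x n < N" "x \<in> Lambda A \<Longrightarrow> A $$ (x n, x (Suc n)) = 1"
  by (auto simp: Lambda_def)

lemma Lambda_shift: "x \<in> Lambda A \<Longrightarrow> (\<lambda>k. x (n + k)) \<in> Lambda A"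
  by (simp add: Lambda_def)

lemma Lambda_prepend_iff:
  "prepend i x \<in> Lambda A \<longleftrightarrow> i < N \<and> x \<in> Lambda A \<and> A $$ (i, x 0) = 1"
  by (auto simp: Lambda_def prepend_def split: nat.splits)

lemma prepend_shift: "prepend (x 0) (\<lambda>k. x (Suc k)) = x"
  by (auto simp: prepend_def fun_eq_iff split: nat.splits)

lemma val_prepend: "x \<in> Lambda A \<Longrightarrow> i < N \<Longrightarrow> val (prepend i x) = real i / real N + 1 / real N * val x"
  using expansion_value_Suc[OF N_ge_2, of "prepend i x"] LambdaD(1)[of x]
  by (auto simp: prepend_def add_divide_distrib split: nat.splits)

text \<open>The unnormalized Hausdorff measure of exponent \<open>s\<close> of the set of numbers represented by a
  set of sequences.\<close>

definition hm :: "(nat \<Rightarrow> nat) set \<Rightarrow> ennreal" where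
  "hm B = hausdorff_outer_measure s (val ` B)"

lemma hm_mono: "B \<subseteq> C \<Longrightarrow> hm B \<le> hm C"
  unfolding hm_def by (intro hausdorff_outer_measure_mono image_mono)

lemma hm_empty [simp]: "hm {} = 0"
  by (simp add: hm_def)

lemma hm_Un_le: "hm (B \<union> C) \<le> hm B + hm C"
  unfolding hm_def image_Un by (rule hausdorff_outer_measure_Un_le)

lemma hm_prepend:
  assumes "B \<subseteq> Lambda A" "i < N"
  shows "hm (prepend i ` B) = ennreal (1 / r) * hm B"
proof -
  have "val ` prepend i ` B = (\<lambda>y. real i / real N + 1 / real N * y) ` val ` B"
    unfolding image_image using assms by (intro image_cong) (auto simp: val_prepend)
  then show ?thesis
    using hausdorff_outer_measure_affine[of "1 / real N" s "real i / real N"] N_ge_2 s_pos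
    by (simp add: hm_def powr_divide N_powr_s)
qed

lemma range_set_eq: "i < N \<Longrightarrow> range_set A i = prepend i ` domain_set A i"
proof (intro equalityI subsetI)
  fix x assume "i < N" "x \<in> range_set A i"
  then have x: "x \<in> Lambda A" "x 0 = i" by (auto simp: range_set_def)
  then have "(\<lambda>k. x (Suc k)) \<in> domain_set A i"
    using Lambda_shift[OF x(1), of 1] LambdaD(2)[OF x(1), of 0] by (auto simp: domain_set_def)
  then show "x \<in> prepend i ` domain_set A i"
    using prepend_shift[of x] x by (intro image_eqI[of _ _ "\<lambda>k. x (Suc k)"]) auto
qed (auto simp: range_set_def domain_set_def Lambda_prepend_iff, auto simp: prepend_def)

lemma domain_set_eq: "domain_set A i = (\<Union>j\<in>{j. j < N \<and> A $$ (i, j) = 1}. range_set A j)"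
  by (auto simp: domain_set_def range_set_def LambdaD)

lemma val_01: "x \<in> Lambda A \<Longrightarrow> 0 \<le> val x \<and> val x \<le> 1"
  using expansion_value_nonneg expansion_value_le_1 LambdaD N_ge_2 by metis

text \<open>Self-similarity transports covers of the pieces \<open>range_set A j\<close> to covers of
  \<open>range_set A i\<close>, scaled by \<open>1/N\<close>.  Because the vector \<open>p\<close> is an eigenvector, the resulting
  bound does not change from one scale to the next.\<close>

lemma hausdorff_premeasure_range_set_le:
  assumes b: "\<And>i. i < N \<Longrightarrow> 1 \<le> b * p $ i" and "i < N"
  shows "hausdorff_premeasure s ((1 / real N) ^ n) (val ` range_set A i) \<le> ennreal (b * p $ i)"
  using assms(2)
proof (induction n arbitrary: i)
  case 0
  let ?U = "\<lambda>n::nat. if n = 0 then val ` range_set A i else {}"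
  have sub: "val ` range_set A i \<subseteq> {0..1}" using val_01 by (auto simp: range_set_def)
  then have bd: "bounded (val ` range_set A i)" by (rule bounded_subset[rotated]) auto
  have d: "diameter (val ` range_set A i) \<le> 1"
    using diameter_subset[OF sub] by simp
  have "hausdorff_premeasure s 1 (val ` range_set A i) \<le> (\<Sum>n. hausdorff_gauge s (?U n))"
    by (rule hausdorff_premeasure_le) (use bd d in auto)
  also have "\<dots> = hausdorff_gauge s (val ` range_set A i)"
    by (subst suminf_finite[of "{0}"]) auto
  also have "\<dots> \<le> 1"
    using d diameter_ge_0[OF bd] s_pos by (simp add: hausdorff_gauge_eq powr_le1)
  also have "\<dots> \<le> ennreal (b * p $ i)" using b[OF 0] by simp
  finally show ?case by simp
next
  case (Suc n)
  let ?J = "{j. j < N \<and> A $$ (i, j) = 1}"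
  let ?f = "\<lambda>y. real i / real N + 1 / real N * y"
  have "val ` range_set A i = (\<Union>j\<in>?J. ?f ` val ` range_set A j)"
  proof -
    have "val ` range_set A i = ?f ` val ` domain_set A i"
      unfolding range_set_eq[OF Suc.prems] image_image using Suc.prems
      by (intro image_cong) (auto simp: val_prepend domain_set_def)
    then show ?thesis by (auto simp: domain_set_eq)
  qed
  then have "hausdorff_premeasure s ((1 / real N) ^ Suc n) (val ` range_set A i)
      \<le> (\<Sum>j\<in>?J. hausdorff_premeasure s ((1 / real N) ^ Suc n) (?f ` val ` range_set A j))"
    using hausdorff_premeasure_finite_UN_le[of ?J "(1 / real N) ^ Suc n" s "\<lambda>j. ?f ` val ` range_set A j"]
    by simp
  also have "\<dots> \<le> (\<Sum>j\<in>?J. ennreal (1 / r) * ennreal (b * p $ j))"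
  proof (rule sum_mono)
    fix j assume j: "j \<in> ?J"
    have "hausdorff_premeasure s ((1 / real N) ^ Suc n) (?f ` val ` range_set A j)
        \<le> ennreal ((1 / real N) powr s) * hausdorff_premeasure s ((1 / real N) ^ n) (val ` range_set A j)"
      unfolding power_Suc using N_ge_2 s_pos
      by (intro hausdorff_premeasure_image_le) (auto simp: dist_real_def simp flip: diff_divide_distrib)
    also have "\<dots> \<le> ennreal (1 / r) * ennreal (b * p $ j)"
      using Suc.IH j N_ge_2 by (intro mult_mono) (auto simp: powr_divide N_powr_s)
    finally show "hausdorff_premeasure s ((1 / real N) ^ Suc n) (?f ` val ` range_set A j)
        \<le> ennreal (1 / r) * ennreal (b * p $ j)" .
  qed
  also have "\<dots> = (\<Sum>j\<in>?J. ennreal (b / r * p $ j))"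
    using r_pos b by (intro sum.cong) (auto simp flip: ennreal_mult' intro: order_trans[OF zero_le_one])
  also have "\<dots> = ennreal (\<Sum>j\<in>?J. b / r * p $ j)"
  proof (rule sum_ennreal)
    fix j assume "j \<in> ?J"
    then have "0 \<le> b * p $ j" using b[of j] by simp
    then show "0 \<le> b / r * p $ j" using r_pos by simp
  qed
  also have "(\<Sum>j\<in>?J. b / r * p $ j) = b * p $ i"
    unfolding sum_distrib_left[symmetric] p_admissible_sum[OF Suc.prems] using r_pos by simp
  finally show ?case .
qed

lemma Lambda_eq_UN: "Lambda A = (\<Union>i<N. range_set A i)"
  by (auto simp: range_set_def LambdaD)

lemma hm_Lambda_finite: "hm (Lambda A) < \<infinity>"
proof -
  define b where "b = Max ((\<lambda>i. 1 / p $ i) ` {..<N})"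
  have b: "1 \<le> b * p $ i" if "i < N" for i
  proof -
    have "1 / p $ i \<le> b" unfolding b_def using that by (intro Max_ge) auto
    then show ?thesis using p_pos[OF that] by (simp add: field_simps)
  qed
  have "hm (range_set A i) \<le> ennreal (b * p $ i)" if "i < N" for i
    unfolding hm_def
  proof (rule hausdorff_outer_measure_least)
    fix \<epsilon> :: real assume "\<epsilon> > 0"
    then obtain n where "(1 / real N) ^ n < \<epsilon>"
      using real_arch_pow_inv[of \<epsilon> "1 / real N"] N_ge_2 by auto
    then show "hausdorff_premeasure s \<epsilon> (val ` range_set A i) \<le> ennreal (b * p $ i)"
      using hausdorff_premeasure_range_set_le[OF b that, of n]
      by (meson hausdorff_premeasure_antimono less_imp_le order_trans)
  qed
  then have fin: "hm (range_set A i) < \<infinity>" if "i < N" for i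
    using that by (metis ennreal_less_top infinity_ennreal_def le_less_trans)
  have "hm (\<Union>i\<in>I. range_set A i) < \<infinity>" if "finite I" "I \<subseteq> {..<N}" for I
    using that
  proof induction
    case (insert i I)
    then have "hm (range_set A i) + hm (\<Union>i\<in>I. range_set A i) < \<infinity>"
      using fin[of i] by (simp add: less_top)
    then show ?case
      using hm_Un_le[of "range_set A i" "\<Union>i\<in>I. range_set A i"] by (auto intro: le_less_trans)
  qed simp
  then show ?thesis unfolding Lambda_eq_UN by blast
qed

text \<open>A cover of the limit set by cylinders (for each \<open>j\<close> the cylinders of level \<open>k j\<close> with codes in
  \<open>C j\<close>) has total weight at least \<open>1/r\<close>, where a cylinder of level \<open>k\<close> weighs \<open>r\<^sup>-\<^sup>k\<close>.
  Otherwise one follows the digits, always entering a subcylinder in which the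
  weight of the covering cylinders is smaller than the Markov mass
  \<open>r\<^sup>-\<^sup>n p\<^sub>i\<close> (where \<open>i\<close> is the last digit); the eigenvalue equation says that the masses of the
  admissible subcylinders add up, so one of them qualifies.  No
  cylinder on this path can belong to the cover, hence the limit
  point is not covered.\<close>

lemma cylinder_cover_weight_ge:
  fixes k :: "nat \<Rightarrow> nat" and C :: "nat \<Rightarrow> nat set"
  assumes fin: "\<And>j. finite (C j)"
    and cover: "\<And>x. x \<in> Lambda A \<Longrightarrow> \<exists>j. code N (k j) x \<in> C j"
  shows "ennreal (1 / r) \<le> (\<Sum>j. ennreal ((1 / r) ^ k j * card (C j)))"
proof (rule ccontr)
  assume "\<not> ?thesis"
  then have less: "(\<Sum>j. ennreal ((1 / r) ^ k j * card (C j))) < ennreal (1 / r)" by simp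
  \<comment> \<open>\<open>D n c j\<close>: codes of the covering cylinders with index \<open>j\<close> inside the cylinder of level \<open>n\<close> and
    code \<open>c\<close>; \<open>\<phi> n c\<close>: their total weight over all \<open>j\<close>\<close>
  define D where "D n c j = {d \<in> C j. n \<le> k j \<and> d div N ^ (k j - n) = c}" for n c j
  define \<phi> where "\<phi> n c = (\<Sum>j. ennreal ((1 / r) ^ k j * card (D n c j)))" for n c
  have finD: "finite (D n c j)" for n c j using fin by (simp add: D_def)
  have card_sum: "(\<Sum>i\<in>I. card (D (Suc n) (N * c + i) j)) \<le> card (D n c j)" if "I \<subseteq> {..<N}" for I n c j
  proof -
    have "finite I" using that finite_subset by blast
    then have "(\<Sum>i\<in>I. card (D (Suc n) (N * c + i) j)) = card (\<Union>i\<in>I. D (Suc n) (N * c + i) j)"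
      using finD by (subst card_UN_disjoint) (auto simp: D_def)
    also have "\<dots> \<le> card (D n c j)"
    proof (rule card_mono[OF finD], rule subsetI)
      fix d assume "d \<in> (\<Union>i\<in>I. D (Suc n) (N * c + i) j)"
      then obtain i where "i \<in> I" "d \<in> D (Suc n) (N * c + i) j" by blast
      then have i: "i < N" "d \<in> C j" "Suc n \<le> k j" "d div N ^ (k j - Suc n) = N * c + i"
        using that by (auto simp: D_def)
      have "k j - n = Suc (k j - Suc n)" using i by simp
      then have "d div N ^ (k j - n) = d div N ^ (k j - Suc n) div N"
        by (metis div_mult2_eq mult.commute power_Suc)
      also have "\<dots> = c" using i by simp
      finally show "d \<in> D n c j" using i by (simp add: D_def)
    qed
    finally show ?thesis .
  qed
  have \<phi>_sum: "(\<Sum>i\<in>I. \<phi> (Suc n) (N * c + i)) \<le> \<phi> n c" if "I \<subseteq> {..<N}" for I n c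
  proof -
    have "(\<Sum>i\<in>I. \<phi> (Suc n) (N * c + i)) = (\<Sum>j. \<Sum>i\<in>I. ennreal ((1 / r) ^ k j * card (D (Suc n) (N * c + i) j)))"
      unfolding \<phi>_def by (rule suminf_sum[symmetric]) auto
    also have "\<dots> \<le> \<phi> n c"
      unfolding \<phi>_def
    proof (intro suminf_le allI)
      fix j
      have "(\<Sum>i\<in>I. ennreal ((1 / r) ^ k j * card (D (Suc n) (N * c + i) j)))
          = ennreal ((1 / r) ^ k j * (\<Sum>i\<in>I. card (D (Suc n) (N * c + i) j)))"
        using r_pos by (subst sum_ennreal) (auto simp: sum_distrib_left)
      also have "\<dots> \<le> ennreal ((1 / r) ^ k j * card (D n c j))"
        using card_sum[OF that, of n c j] r_pos by (intro ennreal_leI mult_left_mono) (auto simp: of_nat_mono simp flip: of_nat_sum)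
      finally show "(\<Sum>i\<in>I. ennreal ((1 / r) ^ k j * card (D (Suc n) (N * c + i) j)))
          \<le> ennreal ((1 / r) ^ k j * card (D n c j))" .
    qed auto
    finally show ?thesis .
  qed
  have child: "\<exists>i\<in>I. \<phi> (Suc n) (N * c + i) < ennreal ((1 / r) ^ Suc n * p $ i)"
    if I: "I \<subseteq> {..<N}" and lt: "\<phi> n c < ennreal ((1 / r) ^ Suc n * (\<Sum>i\<in>I. p $ i))" for I n c
  proof (rule ccontr)
    assume "\<not> ?thesis"
    then have "(\<Sum>i\<in>I. ennreal ((1 / r) ^ Suc n * p $ i)) \<le> (\<Sum>i\<in>I. \<phi> (Suc n) (N * c + i))"
      by (intro sum_mono) (auto simp: not_less)
    also have "\<dots> \<le> \<phi> n c" by (rule \<phi>_sum[OF I])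
    finally have "(\<Sum>i\<in>I. ennreal ((1 / r) ^ Suc n * p $ i)) \<le> \<phi> n c" .
    moreover have "(\<Sum>i\<in>I. ennreal ((1 / r) ^ Suc n * p $ i)) = ennreal ((1 / r) ^ Suc n * (\<Sum>i\<in>I. p $ i))"
      unfolding sum_distrib_left using I p_pos r_pos
      by (intro sum_ennreal) (auto intro!: mult_nonneg_nonneg less_imp_le)
    ultimately show False using lt by simp
  qed
  have \<phi>0: "\<phi> 0 0 < ennreal (1 / r)"
  proof -
    have "\<phi> 0 0 \<le> (\<Sum>j. ennreal ((1 / r) ^ k j * card (C j)))"
      unfolding \<phi>_def using r_pos fin
      by (intro suminf_le allI ennreal_leI mult_left_mono) (auto simp: D_def intro!: card_mono)
    then show ?thesis using less by simp
  qed
  \<comment> \<open>states \<open>(c, i)\<close> of the path: after \<open>n + 1\<close> digits, the code of these digits and the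
    last of them\<close>
  define P where "P n ci \<longleftrightarrow> snd ci < N \<and> \<phi> (Suc n) (fst ci) < ennreal ((1 / r) ^ Suc n * p $ snd ci)" for n and ci :: "nat \<times> nat"
  define Q where "Q ci ci' \<longleftrightarrow> A $$ (snd ci, snd ci') = 1 \<and> fst ci' = N * fst ci + snd ci'" for ci ci' :: "nat \<times> nat"
  have "\<exists>f. f 0 \<in> {ci. fst ci = snd ci} \<and> (\<forall>n. P n (f n) \<and> Q (f n) (f (Suc n)))"
  proof -
    have base: "\<exists>ci. P 0 ci \<and> fst ci = snd ci"
      using child[of "{..<N}" 0 0] \<phi>0 p_sum by (auto simp: P_def)
    have step: "\<exists>ci'. P (Suc n) ci' \<and> Q ci ci'" if "P n ci" for ci n
    proof -
      obtain c i where ci: "ci = (c, i)" by (cases ci)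
      have i: "i < N" "\<phi> (Suc n) c < ennreal ((1 / r) ^ Suc n * p $ i)"
        using that by (auto simp: P_def ci)
      have "(1 / r) ^ Suc n * p $ i = (1 / r) ^ Suc (Suc n) * (\<Sum>j | j < N \<and> A $$ (i, j) = 1. p $ j)"
        using r_pos by (simp add: p_admissible_sum[OF i(1)])
      then have "\<exists>j\<in>{j. j < N \<and> A $$ (i, j) = 1}. \<phi> (Suc (Suc n)) (N * c + j) < ennreal ((1 / r) ^ Suc (Suc n) * p $ j)"
        using i by (intro child) auto
      then obtain j where "j < N" "A $$ (i, j) = 1" "\<phi> (Suc (Suc n)) (N * c + j) < ennreal ((1 / r) ^ Suc (Suc n) * p $ j)"
        by auto
      then show ?thesis by (intro exI[of _ "(N * c + j, j)"]) (auto simp: P_def Q_def ci)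
    qed
    have "\<exists>f. \<forall>n. (P n (f n) \<and> (n = 0 \<longrightarrow> fst (f n) = snd (f n))) \<and> Q (f n) (f (Suc n))"
    proof (rule dependent_nat_choice)
      show "\<exists>x. P 0 x \<and> (0 = (0::nat) \<longrightarrow> fst x = snd x)" using base by auto
    qed (use step in auto)
    then show ?thesis by auto
  qed
  then obtain f where f: "fst (f 0) = snd (f 0)" "\<And>n. P n (f n)" "\<And>n. Q (f n) (f (Suc n))"
    by auto
  define x where "x n = snd (f n)" for n
  have "x \<in> Lambda A" using f by (auto simp: x_def Lambda_def P_def Q_def)
  have code_x: "code N (Suc n) x = fst (f n)" for n
    by (induction n) (use f in \<open>auto simp: x_def Q_def\<close>)
  obtain j where j: "code N (k j) x \<in> C j" using cover[OF \<open>x \<in> Lambda A\<close>] by auto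
  have single: "g j \<le> suminf g" for g :: "nat \<Rightarrow> ennreal"
    using sum_le_suminf[of g "{j}"] by auto
  show False
  proof (cases "k j")
    case 0
    then have "card (C j) \<ge> 1" using j fin[of j] by (metis One_nat_def Suc_leI card_gt_0_iff empty_iff)
    then have "1 \<le> real (card (C j))" by simp
    moreover have "1 / r \<le> 1" using r_gt_1 by simp
    ultimately have "1 / r \<le> (1 / r) ^ k j * card (C j)" unfolding 0 power_0 mult_1 by (rule order_trans[rotated])
    then have "ennreal (1 / r) \<le> ennreal ((1 / r) ^ k j * card (C j))" by (rule ennreal_leI)
    also have "\<dots> \<le> (\<Sum>j. ennreal ((1 / r) ^ k j * card (C j)))"
      by (rule single[of "\<lambda>j. ennreal ((1 / r) ^ k j * card (C j))"])
    finally show False using less by simp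
  next
    case (Suc n)
    have "code N (k j) x \<in> D (Suc n) (fst (f n)) j"
      using j code_x[of n] Suc by (simp add: D_def)
    then have "1 \<le> card (D (Suc n) (fst (f n)) j)"
      using finD by (metis One_nat_def Suc_leI card_gt_0_iff empty_iff)
    moreover have "p $ x n \<le> 1" "0 \<le> p $ x n"
      using f(2)[of n] p_le_1 p_pos by (auto simp: P_def x_def intro: less_imp_le)
    ultimately have "(1 / r) ^ Suc n * p $ x n \<le> (1 / r) ^ k j * card (D (Suc n) (fst (f n)) j)"
      using Suc r_pos by (intro mult_mono) auto
    then have "ennreal ((1 / r) ^ Suc n * p $ x n) \<le> ennreal ((1 / r) ^ k j * card (D (Suc n) (fst (f n)) j))"
      by (rule ennreal_leI)
    also have "\<dots> \<le> \<phi> (Suc n) (fst (f n))"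
      unfolding \<phi>_def by (rule single[of "\<lambda>j. ennreal ((1 / r) ^ k j * card (D (Suc n) (fst (f n)) j))"])
    also have "\<dots> < ennreal ((1 / r) ^ Suc n * p $ x n)"
      using f(2)[of n] by (simp add: P_def x_def)
    finally show False by simp
  qed
qed

text \<open>A set of diameter at most \<open>N\<^sup>-\<^sup>k\<close> meets only cylinders of level \<open>k\<close> whose codes differ by at most
  \<open>2\<close> from that of a fixed one, hence at most five.  With \<open>k\<close> as large as possible, each of these has weight
  \<open>r\<^sup>-\<^sup>k\<close>, at most \<open>r\<close> times the gauge of the set, so an efficient cover of the limit set would
  give a cover by cylinders that is too light.\<close>

lemma hm_Lambda_pos: "hm (Lambda A) \<noteq> 0"
proof
  assume 0: "hm (Lambda A) = 0"
  \<comment> \<open>small enough for \<open>5 r \<cdot> 2 \<eta> < 1 / r\<close>, the final contradiction\<close>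
  define \<eta> where "\<eta> = 1 / (20 * r\<^sup>2)"
  have \<eta>: "0 < \<eta>" "\<eta> \<le> 1" using r_gt_1 by (auto simp: \<eta>_def power2_eq_square field_simps)
      (use mult_mono[of 1 r 1 r] in simp)
  have "hausdorff_premeasure s 1 (val ` Lambda A) < ennreal \<eta>"
    using hausdorff_premeasure_le_outer[of 1 s "val ` Lambda A"] 0 \<eta> by (simp add: hm_def)
  then obtain U where U: "val ` Lambda A \<subseteq> (\<Union>n. U n)" "\<And>n. bounded (U n)" "\<And>n. diameter (U n) \<le> 1"
    "(\<Sum>n. hausdorff_gauge s (U n)) < ennreal \<eta>"
    by (rule hausdorff_premeasure_lessE) blast
  \<comment> \<open>covering sets may have diameter zero, so diameters are enlarged at a total cost of \<open>\<eta>\<close>\<close>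
  define d where "d n = max (diameter (U n)) ((\<eta> * (1/2) ^ Suc n) powr (1 / s))" for n
  have d: "0 < d n" "d n \<le> 1" for n
  proof -
    have "0 < (\<eta> * (1/2) ^ Suc n) powr (1 / s)" using \<eta> by simp
    then show "0 < d n" unfolding d_def by linarith
    have "\<eta> * (1/2) ^ Suc n \<le> 1 * 1" using \<eta> by (intro mult_mono power_le_one) auto
    then show "d n \<le> 1" using U(3)[of n] s_pos \<eta> by (simp add: d_def powr_le1)
  qed
  have "\<exists>k. (1 / real N) ^ Suc k < d n \<and> d n \<le> (1 / real N) ^ k" for n
  proof -
    obtain l where l: "(1 / real N) ^ l < d n"
      using real_arch_pow_inv[OF d(1), of "1 / real N"] N_ge_2 by auto
    define l where "l = (LEAST l. (1 / real N) ^ l < d n)"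
    have "(1 / real N) ^ l < d n" unfolding l_def by (rule LeastI) fact
    moreover have "l \<noteq> 0" using calculation d(2)[of n] by (cases l) auto
    then obtain k where "l = Suc k" by (cases l) auto
    moreover have "\<not> (1 / real N) ^ k < d n"
      using not_less_Least[of k "\<lambda>l. (1 / real N) ^ l < d n"] \<open>l = Suc k\<close> l_def by simp
    ultimately show ?thesis by (intro exI[of _ k]) auto
  qed
  then obtain k where k: "\<And>n. (1 / real N) ^ Suc (k n) < d n" "\<And>n. d n \<le> (1 / real N) ^ k n"
    by metis
  define y where "y n = (SOME x. x \<in> Lambda A \<and> val x \<in> U n)" for n
  define C where "C n = {code N (k n) (y n) - 2 .. code N (k n) (y n) + 2}" for n
  have cover: "\<exists>j. code N (k j) x \<in> C j" if x: "x \<in> Lambda A" for x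
  proof -
    obtain n where n: "val x \<in> U n" using U(1) x by auto
    then have "y n \<in> Lambda A \<and> val (y n) \<in> U n"
      unfolding y_def using x n by (intro someI_ex[of "\<lambda>x. x \<in> Lambda A \<and> val x \<in> U n"]) blast
    then have y: "y n \<in> Lambda A" "val (y n) \<in> U n" by auto
    have "dist (val x) (val (y n)) \<le> diameter (U n)"
      using U(2) n y by (intro diameter_bounded_bound) auto
    also have "\<dots> \<le> (1 / real N) ^ k n" using k(2)[of n] by (simp add: d_def)
    finally have "real N ^ k n * \<bar>val x - val (y n)\<bar> \<le> real N ^ k n * (1 / real N) ^ k n"
      by (intro mult_left_mono) (auto simp: dist_real_def)
    also have "\<dots> = 1" using N_ge_2 by (simp add: power_divide)
    finally have "\<bar>real N ^ k n * val x - real N ^ k n * val (y n)\<bar> \<le> 1"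
      by (simp add: abs_mult flip: right_diff_distrib)
    then have "real (code N (k n) x) \<le> real (code N (k n) (y n)) + 2
      \<and> real (code N (k n) (y n)) \<le> real (code N (k n) x) + 2"
      using expansion_value_code_bounds[where n = "k n" and x = x, OF N_ge_2 LambdaD(1)[OF x]]
        expansion_value_code_bounds[where n = "k n" and x = "y n", OF N_ge_2 LambdaD(1)[OF y(1)]]
      by (intro conjI) linarith+
    then show ?thesis by (intro exI[of _ n]) (auto simp: C_def)
  qed
  have "ennreal (1 / r) \<le> (\<Sum>n. ennreal ((1 / r) ^ k n * card (C n)))"
    using cover by (intro cylinder_cover_weight_ge) (auto simp: C_def)
  also have "\<dots> \<le> (\<Sum>n. ennreal (5 * r) * (hausdorff_gauge s (U n) + ennreal (\<eta> * (1/2) ^ Suc n)))"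
  proof (intro suminf_le allI)
    fix n
    have "card (C n) \<le> 5" by (simp add: C_def)
    moreover have "(1 / r) ^ k n \<le> r * (diameter (U n) powr s + \<eta> * (1/2) ^ Suc n)"
    proof -
      have "(1 / r) ^ k n = r * ((1 / real N) ^ Suc (k n)) powr s"
        using r_pos by (simp add: power_divide powr_divide powr_mult N_powr_s power_powr_s)
      also have "\<dots> \<le> r * d n powr s"
        using k(1)[of n] s_pos r_pos by (intro mult_left_mono powr_mono2) auto
      also have "d n powr s \<le> diameter (U n) powr s + \<eta> * (1/2) ^ Suc n"
      proof -
        have *: "((\<eta> * (1/2) ^ Suc n) powr (1 / s)) powr s = \<eta> * (1/2) ^ Suc n"
          using \<eta> s_pos by (simp add: powr_powr)
        have "d n powr s = diameter (U n) powr s \<or> d n powr s = \<eta> * (1/2) ^ Suc n"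
          unfolding d_def max_def by (simp only: * split: if_split) simp
        moreover have "0 \<le> diameter (U n) powr s" "0 \<le> \<eta> * (1/2) ^ Suc n" using \<eta> by auto
        ultimately show ?thesis by linarith
      qed
      finally show ?thesis using r_pos by simp
    qed
    moreover have "0 \<le> r * (diameter (U n) powr s + \<eta> * (1/2) ^ Suc n)"
      using r_pos \<eta> by (intro mult_nonneg_nonneg add_nonneg_nonneg) auto
    ultimately have "(1 / r) ^ k n * card (C n) \<le> (r * (diameter (U n) powr s + \<eta> * (1/2) ^ Suc n)) * 5"
      using r_pos by (intro mult_mono) auto
    then have "ennreal ((1 / r) ^ k n * card (C n)) \<le> ennreal ((5 * r) * (diameter (U n) powr s + \<eta> * (1/2) ^ Suc n))"
      by (intro ennreal_leI) (simp add: mult_ac)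
    also have "\<dots> = ennreal (5 * r) * (hausdorff_gauge s (U n) + ennreal (\<eta> * (1/2) ^ Suc n))"
      using r_pos s_pos \<eta> by (simp add: ennreal_mult hausdorff_gauge_eq)
    finally show "ennreal ((1 / r) ^ k n * card (C n))
        \<le> ennreal (5 * r) * (hausdorff_gauge s (U n) + ennreal (\<eta> * (1/2) ^ Suc n))" .
  qed auto
  also have "\<dots> = ennreal (5 * r) * ((\<Sum>n. hausdorff_gauge s (U n)) + (\<Sum>n. ennreal (\<eta> * (1/2) ^ Suc n)))"
    by (simp add: suminf_add)
  also have "(\<Sum>n. ennreal (\<eta> * (1/2) ^ Suc n)) = ennreal \<eta>"
  proof -
    have "(\<lambda>n. \<eta> * (1/2) ^ Suc n) sums (\<eta> * 1)" by (intro sums_mult power_half_series)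
    then show ?thesis using \<eta> by (intro suminf_ennreal_eq) auto
  qed
  also have "ennreal (5 * r) * ((\<Sum>n. hausdorff_gauge s (U n)) + ennreal \<eta>) \<le> ennreal (5 * r) * (ennreal \<eta> + ennreal \<eta>)"
    using U(4) by (intro mult_left_mono add_right_mono) auto
  also have "\<dots> = ennreal (1 / (2 * r))"
    using \<eta> r_pos by (simp add: \<eta>_def power2_eq_square flip: ennreal_plus ennreal_mult)
  also have "\<dots> < ennreal (1 / r)" using r_pos by (intro ennreal_lessI) (auto simp: field_simps)
  finally show False by simp
qed

end

section \<open>The measure on the space of admissible sequences\<close>

context limit_set
begin

text \<open>The admissible sequences whose first \<open>n\<close> digits have code \<open>c\<close>; empty for some \<open>c\<close>.\<close>

abbreviation cylinder :: "nat \<Rightarrow> nat \<Rightarrow> (nat \<Rightarrow> nat) set" where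
  "cylinder n c \<equiv> {x \<in> Lambda A. code N n x = c}"

lemma hm_cylinder_le: "hm (cylinder n c) \<le> ennreal ((1 / r) ^ n) * hm (Lambda A)"
proof -
  let ?f = "\<lambda>y. real c / real N ^ n + 1 / real N ^ n * y"
  have "val ` cylinder n c \<subseteq> ?f ` val ` Lambda A"
  proof
    fix y assume "y \<in> val ` cylinder n c"
    then obtain x where x: "x \<in> Lambda A" "code N n x = c" "y = val x" by auto
    then have "y = ?f (val (\<lambda>k. x (n + k)))"
      using expansion_value_split[where n = n and x = x, OF N_ge_2 LambdaD(1)[OF x(1)]] by simp
    then show "y \<in> ?f ` val ` Lambda A" using Lambda_shift[OF x(1), of n] by blast
  qed
  then have "hm (cylinder n c) \<le> hausdorff_outer_measure s (?f ` val ` Lambda A)"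
    unfolding hm_def by (rule hausdorff_outer_measure_mono)
  also have "\<dots> = ennreal ((1 / real N ^ n) powr s) * hm (Lambda A)"
    unfolding hm_def using N_ge_2 s_pos by (intro hausdorff_outer_measure_affine) auto
  also have "(1 / real N ^ n) powr s = (1 / r) ^ n"
    using N_ge_2 by (simp add: powr_divide power_powr_s power_divide)
  finally show ?thesis .
qed

text \<open>The values of two neighbouring cylinders may share an end point, so they need not have positive
  distance.  Removing from one of them its first and its last subcylinder of a deep level
  creates a gap, and by the scaling estimate the removed parts have arbitrarily small
  measure.\<close>

lemma cylinder_caratheodory:
  assumes B: "B \<subseteq> Lambda A"
  shows "hm (B \<inter> cylinder n c) + hm (B - cylinder n c) \<le> hm B"
proof (rule ennreal_le_epsilon)
  fix e :: real assume e: "0 < e"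
  obtain h where h: "hm (Lambda A) = ennreal h" "h \<ge> 0"
    using hm_Lambda_finite by (cases "hm (Lambda A)") auto
  obtain k where k: "(1 / r) ^ k < e / (2 * (h + 1))"
    using real_arch_pow_inv[of "e / (2 * (h + 1))" "1 / r"] e h r_gt_1 by auto
  have small: "hm (cylinder (n + k) c') \<le> ennreal (e / 2)" for c'
  proof -
    have "(1 / r) ^ (n + k) \<le> (1 / r) ^ k"
      using r_gt_1 by (intro power_decreasing) auto
    then have "(1 / r) ^ (n + k) * h \<le> e / (2 * (h + 1)) * (h + 1)"
      using e h k r_pos by (intro mult_mono) auto
    also have "\<dots> = e / 2" using h by (simp add: field_simps)
    finally have *: "(1 / r) ^ (n + k) * h \<le> e / 2" .
    have "hm (cylinder (n + k) c') \<le> ennreal ((1 / r) ^ (n + k) * h)"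
      using hm_cylinder_le[of "n + k" c'] h r_pos by (simp add: ennreal_mult)
    also have "\<dots> \<le> ennreal (e / 2)" using * by (rule ennreal_leI)
    finally show ?thesis .
  qed
  define lo where "lo = c * N ^ k"
  define hi where "hi = (c + 1) * N ^ k - 1"
  define Z where "Z = {x \<in> cylinder n c. code N (n + k) x \<noteq> lo \<and> code N (n + k) x \<noteq> hi}"
  have Nk: "N ^ k \<ge> 1" using N_pos by (simp add: Suc_leI)
  have gap: "1 / real N ^ (n + k) \<le> dist (val x) (val y)"
    if x: "x \<in> Z" and y: "y \<in> Lambda A" "code N n y \<noteq> c" for x y
  proof -
    have xL: "x \<in> Lambda A" and cx: "code N n x = c" using x by (auto simp: Z_def)
    have "lo \<le> code N (n + k) x" "code N (n + k) x < (c + 1) * N ^ k"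
      using code_add[where n = n and k = k and x = x, OF LambdaD(1)[OF xL]] cx by (auto simp: lo_def)
    then have "lo + 1 \<le> code N (n + k) x" "code N (n + k) x + 2 \<le> (c + 1) * N ^ k"
      using x by (auto simp: Z_def hi_def)
    then have "real (lo + 1) \<le> real (code N (n + k) x)"
      "real (code N (n + k) x + 2) \<le> real ((c + 1) * N ^ k)"
      by (simp_all only: of_nat_le_iff)
    then have rx: "real c * real N ^ k + 1 \<le> real (code N (n + k) x)"
      "real (code N (n + k) x) + 2 \<le> (real c + 1) * real N ^ k"
      unfolding lo_def of_nat_add of_nat_mult of_nat_power of_nat_1 of_nat_numeral by this+
    define M where "M = real N ^ (n + k)"
    have M: "M > 0" using N_pos by (simp add: M_def)
    have vx: "real (code N (n + k) x) \<le> M * val x" "M * val x \<le> real (code N (n + k) x) + 1"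
      unfolding M_def
      using expansion_value_code_bounds[where n = "n + k" and x = x, OF N_ge_2 LambdaD(1)[OF xL]] by auto
    have vy: "real (code N n y) \<le> real N ^ n * val y" "real N ^ n * val y \<le> real (code N n y) + 1"
      using expansion_value_code_bounds[where n = n and x = y, OF N_ge_2 LambdaD(1)[OF y(1)]] by auto
    have My: "M * val y = real N ^ k * (real N ^ n * val y)" by (simp add: M_def power_add)
    have "1 \<le> \<bar>M * val x - M * val y\<bar>"
    proof (cases "code N n y < c")
      case True
      then have "real N ^ n * val y \<le> real c" using vy by linarith
      then have "M * val y \<le> real N ^ k * real c" unfolding My by (intro mult_left_mono) auto
      then show ?thesis using rx vx by (simp add: mult.commute)
    next
      case False
      then have "real c + 1 \<le> real N ^ n * val y" using vy y(2) by linarith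
      then have "real N ^ k * (real c + 1) \<le> M * val y" unfolding My by (intro mult_left_mono) auto
      then show ?thesis using rx vx by (simp add: mult.commute)
    qed
    then have "1 \<le> M * \<bar>val x - val y\<bar>" using M by (simp add: abs_mult flip: right_diff_distrib)
    then show ?thesis using M unfolding M_def[symmetric] dist_real_def by (simp add: field_simps)
  qed
  have "hm (B \<inter> Z) + hm (B - cylinder n c) \<le> hm ((B \<inter> Z) \<union> (B - cylinder n c))"
    unfolding hm_def image_Un
  proof (rule hausdorff_outer_measure_separated)
    show "0 < 1 / real N ^ (n + k)" using N_pos by simp
  qed (use gap B in auto)
  also have "\<dots> \<le> hm B" by (rule hm_mono) (auto simp: Z_def)
  finally have main: "hm (B \<inter> Z) + hm (B - cylinder n c) \<le> hm B" .
  have "hm (B \<inter> cylinder n c) \<le> hm ((B \<inter> Z) \<union> (cylinder (n + k) lo \<union> cylinder (n + k) hi))"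
    by (rule hm_mono) (auto simp: Z_def)
  also have "\<dots> \<le> hm (B \<inter> Z) + (hm (cylinder (n + k) lo) + hm (cylinder (n + k) hi))"
    using hm_Un_le by (meson add_left_mono order_trans)
  also have "\<dots> \<le> hm (B \<inter> Z) + (ennreal (e / 2) + ennreal (e / 2))"
    by (intro add_mono small order_refl)
  also have "ennreal (e / 2) + ennreal (e / 2) = ennreal e" using e by (simp flip: ennreal_plus)
  finally have "hm (B \<inter> cylinder n c) + hm (B - cylinder n c)
      \<le> (hm (B \<inter> Z) + ennreal e) + hm (B - cylinder n c)"
    by (rule add_right_mono)
  also have "\<dots> = (hm (B \<inter> Z) + hm (B - cylinder n c)) + ennreal e"
    by (simp only: add.assoc add.commute add.left_commute)
  also have "\<dots> \<le> hm B + ennreal e" by (rule add_right_mono[OF main])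
  finally show "hm (B \<inter> cylinder n c) + hm (B - cylinder n c) \<le> hm B + ennreal e" .
qed

abbreviation borel_sets :: "(nat \<Rightarrow> nat) set set" where
  "borel_sets \<equiv> sets (restrict_space borel (Lambda A))"

text \<open>On subsets of \<open>Lambda A\<close>, the function \<open>hm\<close> is an outer measure, and the sets measurable for it
  in the sense of Caratheodory include the cylinders and therefore all Borel sets.  This makes it
  unnecessary to study the images of Borel sets under the expansion map, which
  is not injective.\<close>

lemma measure_space_hm: "measure_space (Lambda A) borel_sets hm"
proof -
  define L where "L = lambda_system (Lambda A) (Pow (Lambda A)) hm"
  interpret P: sigma_algebra "Lambda A" "Pow (Lambda A)" by (rule sigma_algebra_Pow)
  have "outer_measure_space (Pow (Lambda A)) hm"
    unfolding outer_measure_space_def positive_def increasing_def countably_subadditive_def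
    using hm_mono by (auto simp: hm_def image_UN intro: hausdorff_outer_measure_UN_le)
  then have ms: "measure_space (Lambda A) L hm"
    unfolding L_def by (rule P.caratheodory_lemma)
  then have sa: "sigma_algebra (Lambda A) L" by (simp add: measure_space_def)
  then interpret L: sigma_algebra "Lambda A" L .
  have cyl: "cylinder n c \<in> L" for n c
    unfolding L_def P.lambda_system_eq
  proof (safe)
    fix B assume B: "B \<subseteq> Lambda A"
    have "hm B \<le> hm (B \<inter> cylinder n c) + hm (B - cylinder n c)"
      using hm_Un_le[of "B \<inter> cylinder n c" "B - cylinder n c"] by (simp add: Int_Diff_Un)
    then show "hm (B \<inter> cylinder n c) + hm (B - cylinder n c) = hm B"
      using cylinder_caratheodory[OF B, of n c] by (rule antisym[rotated])
  qed
  have coord: "{x \<in> Lambda A. x i = a} \<in> L" for i a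
  proof (cases "a < N")
    case True
    have "{x \<in> Lambda A. x i = a} = (\<Union>q. cylinder (Suc i) (N * q + a))"
    proof (intro equalityI subsetI)
      fix x assume "x \<in> (\<Union>q. cylinder (Suc i) (N * q + a))"
      then obtain q where q: "x \<in> Lambda A" "N * code N i x + x i = N * q + a" by auto
      then have "(N * code N i x + x i) mod N = (N * q + a) mod N" by simp
      then have "x i = a" using LambdaD(1)[OF q(1), of i] True by simp
      then show "x \<in> {x \<in> Lambda A. x i = a}" using q by simp
    qed auto
    also have "\<dots> \<in> L" by (intro L.countable_UN image_subsetI cyl)
    finally show ?thesis .
  next
    case False
    then have "{x \<in> Lambda A. x i = a} = {}" using LambdaD(1) by auto
    then show ?thesis by (simp only: L.empty_sets)
  qed
  define M where "M = measure_of (Lambda A) L hm"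
  have M: "space M = Lambda A" "sets M = L"
    using L.space_closed by (simp_all add: M_def L.sigma_sets_eq)
  have "(\<lambda>x i. x i) \<in> measurable M (Pi\<^sub>M UNIV (\<lambda>_. borel :: nat measure))"
  proof (rule measurable_PiM_single')
    fix i :: nat
    have "(\<lambda>x. x i) -` {a} \<inter> space M \<in> sets M" for a
    proof -
      have "(\<lambda>x. x i) -` {a} \<inter> space M = {x \<in> Lambda A. x i = a}" by (auto simp: M)
      then show ?thesis by (simp only: M coord)
    qed
    then have "(\<lambda>x. x i) \<in> measurable M (count_space UNIV)"
      by (simp add: measurable_count_space_eq2_countable)
    then show "(\<lambda>x. x i) \<in> borel_measurable M"
      by (simp only: measurable_cong_sets[OF refl sets_borel_eq_count_space])
  qed simp
  then have id: "(\<lambda>x. x) \<in> borel_measurable M"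
    unfolding measurable_cong_sets[OF refl sets_PiM_equal_borel] .
  have "borel_sets \<subseteq> L"
  proof
    fix B assume "B \<in> borel_sets"
    then obtain X where X: "X \<in> sets borel" "B = Lambda A \<inter> X"
      by (auto simp: sets_restrict_space)
    have "(\<lambda>x. x) -` X \<inter> space M \<in> sets M" using id X(1) by (rule measurable_sets)
    then show "B \<in> L" using X M by (simp add: Int_commute)
  qed
  moreover have "sigma_algebra (Lambda A) borel_sets"
    using sets.sigma_algebra_axioms[of "restrict_space borel (Lambda A)"] by (simp add: space_restrict_space)
  ultimately show ?thesis by (intro measure_down[OF ms])
qed

lemma Lambda_real_dim: "hausdorff_dim (Lambda_real A) = ereal s"
  using hm_Lambda_pos hm_Lambda_finite s_pos by (intro hausdorff_dim_eqI) (auto simp: hm_def)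

lemma delta_eq: "delta A = s"
  by (simp only: delta_def Lambda_real_dim real_of_ereal.simps)

lemma N_powr_delta: "real N powr (- delta A) = 1 / r"
  by (simp add: delta_eq powr_minus N_powr_s inverse_eq_divide)

lemma space_mu: "space (mu A) = Lambda A" and sets_mu: "sets (mu A) = borel_sets"
  and emeasure_mu: "B \<in> borel_sets \<Longrightarrow> emeasure (mu A) B = hm B / hm (Lambda A)"
proof -
  have mu: "mu A = measure_of (Lambda A) borel_sets (\<lambda>B. hm B / hm (Lambda A))"
    by (simp add: mu_def delta_eq hm_def)
  have sa: "sigma_algebra (Lambda A) borel_sets"
    using measure_space_hm by (simp add: measure_space_def)
  then interpret S: sigma_algebra "Lambda A" borel_sets .
  show "space (mu A) = Lambda A" "sets (mu A) = borel_sets"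
    unfolding mu using S.space_closed by (simp_all add: S.sigma_sets_eq)
  show "emeasure (mu A) B = hm B / hm (Lambda A)" if "B \<in> borel_sets"
    unfolding mu
  proof (rule emeasure_measure_of_sigma[OF sa _ _ that])
    show "countably_additive borel_sets (\<lambda>B. hm B / hm (Lambda A))"
      using measure_space_hm by (auto simp: measure_space_def countably_additive_def)
  qed (simp add: positive_def)
qed

lemma Lambda_sets: "Lambda A \<in> borel_sets"
  using sets.top[of "mu A"] by (simp add: space_mu sets_mu)

lemma emeasure_mu_Lambda: "emeasure (mu A) (Lambda A) = 1"
proof -
  have "hm (Lambda A) \<noteq> top_class.top" using hm_Lambda_finite by auto
  then show ?thesis
    using hm_Lambda_pos by (simp add: emeasure_mu Lambda_sets ennreal_divide_self less_top)
qed

sublocale mu: finite_measure "mu A"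
  by (rule finite_measureI) (simp add: space_mu emeasure_mu_Lambda)

lemma range_set_sets: "range_set A i \<in> borel_sets"
proof -
  have "(\<lambda>x::nat \<Rightarrow> nat. x 0) -` {i} \<inter> space borel \<in> sets borel"
    by (intro measurable_sets[OF borel_measurable_continuous_onI]) auto
  then show ?thesis
    by (auto simp: sets_restrict_space range_set_def intro!: image_eqI[of _ _ "(\<lambda>x. x 0) -` {i}"])
qed

lemma domain_set_sets: "domain_set A i \<in> borel_sets"
  unfolding domain_set_eq by (intro sets.finite_UN range_set_sets) auto

lemma prepend_image_sets:
  assumes B: "B \<in> borel_sets" "B \<subseteq> domain_set A i" and i: "i < N"
  shows "prepend i ` B \<in> borel_sets"
proof -
  obtain X where X: "X \<in> sets borel" "B = Lambda A \<inter> X"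
    using B(1) by (auto simp: sets_restrict_space)
  have "(\<lambda>(x::nat \<Rightarrow> nat) k. x (Suc k)) \<in> borel_measurable borel"
    by (intro borel_measurable_continuous_onI continuous_on_coordinatewise_then_product) simp
  then have "(\<lambda>(x::nat \<Rightarrow> nat) k. x (Suc k)) -` X \<in> sets borel"
    using measurable_sets[OF _ X(1)] by (metis Int_UNIV_right space_borel)
  then have "Lambda A \<inter> ((\<lambda>(x::nat \<Rightarrow> nat) k. x (Suc k)) -` X) \<in> borel_sets"
    by (auto simp: sets_restrict_space)
  moreover have "prepend i ` B = range_set A i \<inter> (Lambda A \<inter> ((\<lambda>(x::nat \<Rightarrow> nat) k. x (Suc k)) -` X))"
  proof (intro equalityI subsetI)
    fix x assume "x \<in> prepend i ` B"
    then obtain y where y: "y \<in> B" "x = prepend i y" by auto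
    then have "x \<in> range_set A i" using B(2) range_set_eq[OF i] by auto
    then show "x \<in> range_set A i \<inter> (Lambda A \<inter> ((\<lambda>(x::nat \<Rightarrow> nat) k. x (Suc k)) -` X))"
      using y X by (auto simp: range_set_def prepend_def)
  next
    fix x assume x: "x \<in> range_set A i \<inter> (Lambda A \<inter> ((\<lambda>(x::nat \<Rightarrow> nat) k. x (Suc k)) -` X))"
    then have "(\<lambda>k. x (Suc k)) \<in> B"
      using X Lambda_shift[of x 1] by auto
    then show "x \<in> prepend i ` B"
      using prepend_shift[of x] x by (auto simp: range_set_def intro!: image_eqI[of _ _ "\<lambda>k. x (Suc k)"])
  qed
  ultimately show ?thesis using range_set_sets by (simp add: sets.Int)
qed

lemma prepend_vimage_sets:
  assumes "E \<in> borel_sets"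
  shows "{x \<in> domain_set A i. prepend i x \<in> E} \<in> borel_sets"
proof -
  obtain X where X: "X \<in> sets borel" "E = Lambda A \<inter> X"
    using assms by (auto simp: sets_restrict_space)
  have "prepend i \<in> borel_measurable borel"
  proof (intro borel_measurable_continuous_onI continuous_on_coordinatewise_then_product)
    show "continuous_on UNIV (\<lambda>x. prepend i x k)" for k
      by (cases k) (auto simp: prepend_def)
  qed
  then have "prepend i -` X \<in> sets borel"
    using measurable_sets[OF _ X(1)] by (metis Int_UNIV_right space_borel)
  then have 1: "Lambda A \<inter> (prepend i -` X) \<in> borel_sets"
    by (auto simp: sets_restrict_space)
  show ?thesis
  proof (cases "i < N")
    case True
    then have "{x \<in> domain_set A i. prepend i x \<in> E} = domain_set A i \<inter> (Lambda A \<inter> (prepend i -` X))"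
      using X Lambda_prepend_iff by (auto simp: domain_set_def)
    then show ?thesis using 1 domain_set_sets[of i] by (simp add: sets.Int)
  next
    case False
    then have "{x \<in> domain_set A i. prepend i x \<in> E} = {}"
      using X Lambda_prepend_iff by auto
    then show ?thesis by (simp only: sets.empty_sets)
  qed
qed

lemma emeasure_mu_prepend:
  assumes B: "B \<in> borel_sets" "B \<subseteq> domain_set A i" and i: "i < N"
  shows "emeasure (mu A) (prepend i ` B) = ennreal (1 / r) * emeasure (mu A) B"
proof -
  have "B \<subseteq> Lambda A" using B by (auto simp: domain_set_def)
  then show ?thesis
    by (simp only: emeasure_mu prepend_image_sets[OF assms] B hm_prepend i ennreal_times_divide)
qed

lemma mu_comp_prepend_eq:
  assumes i: "i < N"
  shows "mu_comp_prepend A i = density (mu_on_domain A i) (\<lambda>_. ennreal (1 / r))"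
proof -
  let ?M = "mu_on_domain A i" and ?D = "density (mu_on_domain A i) (\<lambda>_. ennreal (1 / r))"
  have DL: "domain_set A i \<subseteq> Lambda A" by (auto simp: domain_set_def)
  have sp: "space ?M = domain_set A i"
    using DL by (auto simp: space_restrict_space space_mu)
  have "mu_comp_prepend A i = measure_of (space ?D) (sets ?D) (emeasure ?D)"
    unfolding mu_comp_prepend_def space_density sets_density sp
  proof (rule measure_of_eq)
    show "sets ?M \<subseteq> Pow (domain_set A i)"
      using sets.space_closed[of ?M] by (simp only: sp)
    fix B assume "B \<in> sigma_sets (domain_set A i) (sets ?M)"
    then have BM: "B \<in> sets ?M" using sets.sigma_sets_eq[of ?M] by (simp only: sp)
    have D: "domain_set A i \<inter> space (mu A) \<in> sets (mu A)"
      using domain_set_sets[of i] DL by (simp add: space_mu sets_mu Int_absorb2)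
    from BM have B: "B \<in> borel_sets" "B \<subseteq> domain_set A i"
      by (simp_all add: sets_restrict_space_iff[OF D] sets_mu)
    have "emeasure ?D B = ennreal (1 / r) * emeasure ?M B"
      using BM by (subst emeasure_density) (auto simp: nn_integral_cmult)
    also have "emeasure ?M B = emeasure (mu A) B"
      using B domain_set_sets[of i] DL
      by (intro emeasure_restrict_space) (auto simp: space_mu sets_mu Int_absorb2)
    finally show "emeasure (mu A) (prepend i ` B) = emeasure ?D B"
      using emeasure_mu_prepend[OF B i] by simp
  qed
  also have "\<dots> = ?D" by (rule measure_of_of_measure)
  finally show ?thesis .
qed

lemma RN_deriv_prepend:
  assumes i: "i < N"
  shows "AE x in mu_on_domain A i.
    RN_deriv (mu_on_domain A i) (mu_comp_prepend A i) x = ennreal (1 / r)"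
proof -
  interpret M: finite_measure "mu_on_domain A i"
    by (intro finite_measure_restrict_space mu.finite_measure_axioms)
      (simp add: sets_mu domain_set_sets)
  have "AE x in mu_on_domain A i.
      ennreal (1 / r) = RN_deriv (mu_on_domain A i) (mu_comp_prepend A i) x"
    by (intro M.RN_deriv_unique mu_comp_prepend_eq[OF i, symmetric]) simp
  then show ?thesis by eventually_elim simp
qed

text \<open>The piece \<open>range_set A i\<close> is a copy, scaled by \<open>1/r\<close> in measure, of the disjoint union of the
  pieces \<open>range_set A j\<close> with \<open>A\<^sub>i\<^sub>j = 1\<close>.  So the measures of the pieces form a Perron--Frobenius vector, and
  this vector is unique.\<close>

lemma emeasure_range_set:
  assumes q: "perron_frobenius_vector A q" and i: "i < N"
  shows "emeasure (mu A) (range_set A i) = ennreal (q $ i)"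
proof -
  define h where "h i = measure (mu A) (range_set A i)" for i
  have h_sum: "measure (mu A) (\<Union>j\<in>J. range_set A j) = (\<Sum>j\<in>J. h j)" if "finite J" for J
    unfolding h_def using that range_set_sets
    by (intro mu.finite_measure_finite_Union) (auto simp: sets_mu disjoint_family_on_def range_set_def)
  have h_eq: "h i = 1 / r * (\<Sum>j | j < N \<and> A $$ (i, j) = 1. h j)" if "i < N" for i
  proof -
    have "ennreal (h i) = ennreal (1 / r) * ennreal (measure (mu A) (domain_set A i))"
      using emeasure_mu_prepend[OF domain_set_sets order_refl that]
      by (simp add: h_def range_set_eq[OF that] mu.emeasure_eq_measure)
    then have "h i = 1 / r * measure (mu A) (domain_set A i)"
      using r_pos by (simp add: h_def flip: ennreal_mult)
    then show ?thesis using h_sum[of "{j. j < N \<and> A $$ (i, j) = 1}"] by (simp add: domain_set_eq)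
  qed
  have h_total: "(\<Sum>i<N. h i) = 1"
    using h_sum[of "{..<N}"] emeasure_mu_Lambda
    by (simp add: measure_def flip: Lambda_eq_UN)
  define v where "v = vec N h"
  have v: "v \<in> carrier_vec N" by (simp add: v_def)
  have "(A *\<^sub>v v) $ i = r * h i" if "i < N" for i
  proof -
    have "(A *\<^sub>v v) $ i = (\<Sum>j<N. A $$ (i, j) * h j)"
      unfolding mult_mat_vec_sum[OF A v that] by (intro sum.cong) (auto simp: v_def)
    also have "\<dots> = (\<Sum>j | j < N \<and> A $$ (i, j) = 1. h j)"
      using zero_one[OF that] by (intro sum.mono_neutral_cong_right) auto
    also have "\<dots> = r * h i" using h_eq[OF that] r_pos by simp
    finally show ?thesis .
  qed
  then have "A *\<^sub>v v = r \<cdot>\<^sub>v v"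
    using A by (intro eq_vecI) (auto simp: v_def simp del: index_mult_mat_vec)
  moreover have "(\<Sum>i<N. v $ i) = 1" using h_total by (simp add: v_def)
  moreover have "v \<noteq> 0\<^sub>v N" using calculation(2) by auto
  ultimately have "perron_frobenius_vector A v"
    unfolding perron_frobenius_vector_def eigenvector_def
    by (auto simp: v_def h_def simp del: index_mult_mat_vec)
  then have "v = q" by (rule perron_vector_unique[OF q])
  then show ?thesis using i by (auto simp: v_def h_def mu.emeasure_eq_measure)
qed

lemma mu_self_similar:
  assumes "E \<in> sets (mu A)"
  shows "emeasure (mu A) E
    = ennreal (1 / r) * (\<Sum>k<N. emeasure (mu A) {x \<in> domain_set A k. prepend k x \<in> E})"
proof -
  have E: "E \<in> borel_sets" "E \<subseteq> Lambda A"
    using assms sets.sets_into_space[OF assms] by (auto simp: sets_mu space_mu)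
  have "emeasure (mu A) E = (\<Sum>k<N. emeasure (mu A) (E \<inter> range_set A k))"
  proof (rule sum_emeasure_cover)
    show "E \<subseteq> (\<Union>k<N. range_set A k)" using E(2) unfolding Lambda_eq_UN .
    show "disjoint_family_on (range_set A) {..<N}"
      by (auto simp: disjoint_family_on_def range_set_def)
  qed (use assms range_set_sets in \<open>auto simp: sets_mu\<close>)
  also have "\<dots> = (\<Sum>k<N. ennreal (1 / r) * emeasure (mu A) {x \<in> domain_set A k. prepend k x \<in> E})"
  proof (rule sum.cong)
    fix k assume "k \<in> {..<N}"
    then have k: "k < N" by simp
    have "E \<inter> range_set A k = prepend k ` {x \<in> domain_set A k. prepend k x \<in> E}"
      unfolding range_set_eq[OF k] by auto
    then show "emeasure (mu A) (E \<inter> range_set A k)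
        = ennreal (1 / r) * emeasure (mu A) {x \<in> domain_set A k. prepend k x \<in> E}"
      using emeasure_mu_prepend[OF prepend_vimage_sets[OF E(1)] _ k] by auto
  qed simp
  finally show ?thesis by (simp add: sum_distrib_left)
qed

end

section \<open>The theorem on the dimension and measure of the limit set\<close>

theorem theorem2p17:
  fixes N :: nat and A :: "real mat"
  assumes "N \<ge> 2"
    and "A \<in> carrier_mat N N"
    and "\<forall>i<N. \<forall>j<N. A $$ (i, j) \<in> {0, 1}"
    and "\<forall>i<N. A $$ (i, i) = 1"
    and "\<exists>n. \<forall>i<N. \<forall>j<N. (A ^\<^sub>m n) $$ (i, j) > 0"
  shows
    "(\<forall>i<N. AE x in mu_on_domain A i.
        RN_deriv (mu_on_domain A i) (mu_comp_prepend A i) x = ennreal (real N powr (- delta A)))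
     \<and> ((\<exists>!p. perron_frobenius_vector A p)
        \<and> (\<forall>p. perron_frobenius_vector A p \<longrightarrow>
              (\<forall>i<N. emeasure (mu A) (range_set A i) = ennreal (p $ i))))
     \<and> (ereal (delta A) = hausdorff_dim (Lambda_real A)
        \<and> hausdorff_dim (Lambda_real A) = ereal (ln (perron_root A) / ln (real N)))
     \<and> (\<forall>E\<in>sets (mu A). emeasure (mu A) E =
          ennreal (real N powr (- delta A)) *
          (\<Sum>k<N. emeasure (mu A) {x \<in> domain_set A k. prepend k x \<in> E}))"
proof -
  obtain m where m: "\<And>i j. i < N \<Longrightarrow> j < N \<Longrightarrow> (A ^\<^sub>m m) $$ (i, j) > 0"
    using assms(5) by blast
  \<comment> \<open>the identity matrix has zeros off the diagonal\<close>
  have "m \<noteq> 0"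
  proof
    assume "m = 0"
    then show False using m[of 0 1] assms(1,2) by simp
  qed
  then interpret limit_set A N m
  proof unfold_locales
    show "0 \<le> A $$ (i, j)" "A $$ (i, j) = 0 \<or> A $$ (i, j) = 1" if "i < N" "j < N" for i j
      using assms(3) that by force+
  qed (use assms m in auto)
  have "\<exists>!p. perron_frobenius_vector A p"
    using perron_vector_exists perron_vector_unique by blast
  moreover have "ereal (delta A) = hausdorff_dim (Lambda_real A)"
    "hausdorff_dim (Lambda_real A) = ereal (ln r / ln (real N))"
    by (simp_all only: delta_eq Lambda_real_dim flip: s_def)
  ultimately show ?thesis
    unfolding N_powr_delta using RN_deriv_prepend emeasure_range_set mu_self_similar by blast
qed

end
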